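(* Let $(\mathcal{A},\partial,\bar\partial)$ be a bounded bicomplex. The following are equivalent: (1) $\operatorname{pdef}(\mathcal{A})=0$. (2) The de Rham (total) cohomology $H^k_{\mathrm{dR}}(\mathcal{A})$ inherits a pure Hodge structure of weight $k$ in all degrees $k$. (3) The purity obstruction groups vanish for all $k$: $H^k_\urcorner(\mathcal{A})=0$ and $H^k_\llcorner(\mathcal{A})=0$. (4) The natural maps induced by the identity, $$\phi:H^k_{BC}(\mathcal{A})\to H^k(\operatorname{Ker} d^c)\quad\text{and}\quad\psi:H^k(\mathcal{A}/\operatorname{Im} d^c)\to H^k_A(\mathcal{A}),$$ are isomorphisms for all $k$.
   Context: A bicomplex is a bigraded $\mathbb{C}$-vector space $\mathcal{A}=\bigoplus_{p,q\in\mathbb{Z}}\mathcal{A}^{p,q}$ with endomorphisms $\partial,\bar\partial$ of bidegrees $(1,0),(0,1)$ such that $d=\partial+\bar\partial$ satisfies $d^2=0$; bounded means $\mathcal{A}^{p,q}=0$ for all but finitely many $(p,q)$. $\mathcal{A}^k=\bigoplus_{p+q=k}\mathcal{A}^{p,q}$ and $d^c=i(\bar\partial-\partial)$, so $dd^c+d^cd=0$. $H_{\mathrm{dR}}(\mathcal{A})=\operatorname{Ker} d/\operatorname{Im} d$. $\operatorname{Ker} d^c$ and $\mathcal{A}/\operatorname{Im} d^c$ are complexes with differential induced by $d$; explicitly, $H(\operatorname{Ker} d^c)=\dfrac{\operatorname{Ker} d\cap\operatorname{Ker} d^c}{d(\operatorname{Ker} d^c)}$ and $H(\mathcal{A}/\operatorname{Im}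 d^c)=\dfrac{d^{-1}(\operatorname{Im} d^c)}{\operatorname{Im} d+\operatorname{Im} d^c}$. In degree $k$: $H_{BC}=\dfrac{\operatorname{Ker} d\cap\operatorname{Ker} d^c}{\operatorname{Im} dd^c}$, $H_A=\dfrac{\operatorname{Ker} dd^c}{\operatorname{Im} d+\operatorname{Im} d^c}$, $H_\urcorner=\dfrac{d(\operatorname{Ker} d^c)}{\operatorname{Im} dd^c}$, $H_\llcorner=\dfrac{\operatorname{Ker} dd^c}{d^{-1}(\operatorname{Im} d^c)}$ (each taken in total degree $k$). Let $F^pH^k$ (resp. $\bar F^qH^k$) be the subspace of $H^k=H^k_{\mathrm{dR}}(\mathcal{A})$ of classes representable by $d$-closed elements of $\bigoplus_{r\ge p}\mathcal{A}^{r,k-r}$ (resp. of $\bigoplus_{s\ge q}\mathcal{A}^{k-s,s}$). $H^k$ inherits a pure Hodge structure of weight $k$ if $H^k=\bigoplus_{p+q=k}F^pH^k\cap\bar F^qH^k$. Put $F^r_{tot}H^k=\sum_{p+q=r}F^pH^k\cap\bar F^qH^k$, $\operatorname{pdef}_k(\mathcal{A})=\max\{|e|:e\in\mathbb{Z},\ \operatorname{gr}^{k+e}_{F_{tot}}H^k\ne0\}$ ($0$ if $H^k=0$), and $\operatorname{pdef}(\mathcal{A})=\max_k\operatorname{pdef}_k(\mathcal{A})$. *)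

theory Defs
  imports Complex_Main "HOL-Algebra.AbelCoset" "HOL-Algebra.Module"
begin

text \<open>
  Cohomology spaces are represented as records of the library type \<open>(complex, 'b) module\<close>, used
  as complex vector spaces with an explicit carrier. The ring fields \<open>mult\<close> and \<open>one\<close> of such a
  record carry no information.
\<close>

text \<open>The quotient \<open>V / W\<close> of subspaces \<open>W \<subseteq> V\<close> of \<open>M\<close>. Its elements are the cosets of \<open>W\<close>. The
  scalar multiple is re-saturated by \<open>W\<close> so that \<open>0\<close> times a class is \<open>W\<close> rather than \<open>{0}\<close>.\<close>

definition quotient_module ::
  "(complex, 'b) module \<Rightarrow> 'b set \<Rightarrow> 'b set \<Rightarrow> (complex, 'b set) module" where
  "quotient_module M V W =
     \<lparr>carrier = (\<lambda>x. W +>\<^bsub>M\<^esub> x) ` V, mult = undefined, one = undefined,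
      zero = W, add = set_add M, smult = (\<lambda>c X. \<Union>x\<in>X. W +>\<^bsub>M\<^esub> (c \<odot>\<^bsub>M\<^esub> x))\<rparr>"

definition zero_module :: "(complex, 'b) module \<Rightarrow> bool" where
  "zero_module M \<longleftrightarrow> carrier M = {\<zero>\<^bsub>M\<^esub>}"

definition linear_iso ::
  "(complex, 'b) module \<Rightarrow> (complex, 'c) module \<Rightarrow> ('b \<Rightarrow> 'c) \<Rightarrow> bool" where
  "linear_iso M N f \<longleftrightarrow> f \<in> iso (add_monoid M) (add_monoid N) \<and>
     (\<forall>c. \<forall>x\<in>carrier M. f (c \<odot>\<^bsub>M\<^esub> x) = c \<odot>\<^bsub>N\<^esub> f x)"

definition sum_of_subspaces ::
  "(complex, 'b) module \<Rightarrow> 'i set \<Rightarrow> ('i \<Rightarrow> 'b set) \<Rightarrow> 'b set" where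
  "sum_of_subspaces M I N = {finsum M f J | f J. finite J \<and> J \<subseteq> I \<and> f \<in> (\<Pi> i\<in>J. N i)}"

definition direct_sum_decomposition ::
  "(complex, 'b) module \<Rightarrow> 'i set \<Rightarrow> ('i \<Rightarrow> 'b set) \<Rightarrow> bool" where
  "direct_sum_decomposition M I N \<longleftrightarrow>
     (\<forall>i\<in>I. N i \<subseteq> carrier M) \<and>
     (\<forall>x\<in>carrier M. \<exists>!f. f \<in> (\<Pi>\<^sub>E i\<in>I. N i) \<and> finite {i\<in>I. f i \<noteq> \<zero>\<^bsub>M\<^esub>} \<and>
        x = finsum M f {i\<in>I. f i \<noteq> \<zero>\<^bsub>M\<^esub>})"

definition whole_module :: "(complex \<Rightarrow> 'a \<Rightarrow> 'a) \<Rightarrow> (complex, 'a::ab_group_add) module" where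
  "whole_module scale =
     \<lparr>carrier = UNIV, mult = undefined, one = undefined, zero = 0, add = (+), smult = scale\<rparr>"

text \<open>If \<open>V \<subseteq> V'\<close> and \<open>W \<subseteq> W'\<close>, then \<open>induced_by_id M W'\<close> is the map \<open>V / W \<rightarrow> V' / W'\<close>,
  \<open>[x] \<mapsto> [x]\<close>; see \<open>induced_by_id_coset\<close> below.\<close>

definition induced_by_id :: "(complex, 'b) module \<Rightarrow> 'b set \<Rightarrow> 'b set \<Rightarrow> 'b set" where
  "induced_by_id M W' X = (\<Union>x\<in>X. W' +>\<^bsub>M\<^esub> x)"

locale bicomplex = vector_space scale
  for scale :: "complex \<Rightarrow> 'a::ab_group_add \<Rightarrow> 'a" +
  fixes A :: "int \<Rightarrow> int \<Rightarrow> 'a set" and del delb :: "'a \<Rightarrow> 'a"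
  assumes subspace_A: "subspace (A p q)"
    and grading: "direct_sum_decomposition (whole_module scale) UNIV (\<lambda>(p, q). A p q)"
    and linear_del: "Vector_Spaces.linear scale scale del"
    and linear_delb: "Vector_Spaces.linear scale scale delb"
    and del_bidegree: "del ` A p q \<subseteq> A (p + 1) q"
    and delb_bidegree: "delb ` A p q \<subseteq> A p (q + 1)"
    and d_squared: "del (del x + delb x) + delb (del x + delb x) = 0"
begin

definition d :: "'a \<Rightarrow> 'a" where "d x = del x + delb x"

definition dc :: "'a \<Rightarrow> 'a" where "dc x = scale \<i> (delb x - del x)"

definition Ker_d :: "'a set" where "Ker_d = {x. d x = 0}"
definition Ker_dc :: "'a set" where "Ker_dc = {x. dc x = 0}"
definition Ker_ddc :: "'a set" where "Ker_ddc = {x. d (dc x) = 0}"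
definition Im_d :: "'a set" where "Im_d = range d"
definition Im_dc :: "'a set" where "Im_dc = range dc"
definition Im_ddc :: "'a set" where "Im_ddc = range (\<lambda>x. d (dc x))"
definition Im_d_plus_Im_dc :: "'a set" where "Im_d_plus_Im_dc = {x + y | x y. x \<in> Im_d \<and> y \<in> Im_dc}"

definition total :: "int \<Rightarrow> 'a set" where
  "total k = span (\<Union>p. A p (k - p))"

text \<open>The degree \<open>k\<close> part of \<open>V / W\<close> for graded subspaces \<open>W \<subseteq> V\<close>.\<close>

definition degree_quotient :: "'a set \<Rightarrow> 'a set \<Rightarrow> int \<Rightarrow> (complex, 'a set) module" where
  "degree_quotient V W k = quotient_module (whole_module scale) (V \<inter> total k) (W \<inter> total k)"

definition H_dR :: "int \<Rightarrow> (complex, 'a set) module" where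
  "H_dR = degree_quotient Ker_d Im_d"

definition H_Ker_dc :: "int \<Rightarrow> (complex, 'a set) module" where
  "H_Ker_dc = degree_quotient (Ker_d \<inter> Ker_dc) (d ` Ker_dc)"

definition H_mod_Im_dc :: "int \<Rightarrow> (complex, 'a set) module" where
  "H_mod_Im_dc = degree_quotient (d -` Im_dc) Im_d_plus_Im_dc"

definition H_BC :: "int \<Rightarrow> (complex, 'a set) module" where
  "H_BC = degree_quotient (Ker_d \<inter> Ker_dc) Im_ddc"

definition H_A :: "int \<Rightarrow> (complex, 'a set) module" where
  "H_A = degree_quotient Ker_ddc Im_d_plus_Im_dc"

text \<open>The purity obstruction groups $H_\urcorner$ and $H_\llcorner$.\<close>

definition H_urcorner :: "int \<Rightarrow> (complex, 'a set) module" where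
  "H_urcorner = degree_quotient (d ` Ker_dc) Im_ddc"

definition H_llcorner :: "int \<Rightarrow> (complex, 'a set) module" where
  "H_llcorner = degree_quotient Ker_ddc (d -` Im_dc)"

definition phi :: "int \<Rightarrow> 'a set \<Rightarrow> 'a set" where
  "phi k = induced_by_id (whole_module scale) (d ` Ker_dc \<inter> total k)"

definition psi :: "int \<Rightarrow> 'a set \<Rightarrow> 'a set" where
  "psi k = induced_by_id (whole_module scale) (Im_d_plus_Im_dc \<inter> total k)"

text \<open>The filtrations \<open>F\<close> and its conjugate on the total degree \<open>k\<close> part and on \<open>H_dR k\<close>.\<close>

definition Fil :: "int \<Rightarrow> int \<Rightarrow> 'a set" where
  "Fil p k = span (\<Union>r\<in>{p..}. A r (k - r))"

definition Fil_conj :: "int \<Rightarrow> int \<Rightarrow> 'a set" where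
  "Fil_conj q k = span (\<Union>s\<in>{q..}. A (k - s) s)"

definition F :: "int \<Rightarrow> int \<Rightarrow> 'a set set" where
  "F p k = {X \<in> carrier (H_dR k). \<exists>x\<in>X. x \<in> Fil p k \<and> d x = 0}"

definition F_conj :: "int \<Rightarrow> int \<Rightarrow> 'a set set" where
  "F_conj q k = {X \<in> carrier (H_dR k). \<exists>x\<in>X. x \<in> Fil_conj q k \<and> d x = 0}"

definition pure_Hodge_structure :: "int \<Rightarrow> bool" where
  "pure_Hodge_structure k \<longleftrightarrow>
     direct_sum_decomposition (H_dR k) (UNIV :: int set) (\<lambda>p. F p k \<inter> F_conj (k - p) k)"

definition F_tot :: "int \<Rightarrow> int \<Rightarrow> 'a set set" where
  "F_tot r k = sum_of_subspaces (H_dR k) (UNIV :: int set) (\<lambda>p. F p k \<inter> F_conj (r - p) k)"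

definition gr_F_tot :: "int \<Rightarrow> int \<Rightarrow> (complex, 'a set set) module" where
  "gr_F_tot r k = quotient_module (H_dR k) (F_tot r k) (F_tot (r + 1) k)"

text \<open>The maxima below are meant for bounded bicomplexes, where both sets are finite. If \<open>H_dR k\<close>
  is nonzero, some graded piece is nonzero, because \<open>F_tot\<close> is then exhaustive and separated.\<close>

definition pdef_deg :: "int \<Rightarrow> int" where
  "pdef_deg k = (if zero_module (H_dR k) then 0
                 else Max {\<bar>e\<bar> | e. \<not> zero_module (gr_F_tot (k + e) k)})"

definition pdef :: int where
  "pdef = Max (range pdef_deg)"

end

locale bounded_bicomplex = bicomplex +
  assumes bounded: "finite {(p, q). A p q \<noteq> {0}}"

lemma (in bicomplex) induced_by_id_coset:
  assumes "subspace W" "subspace W'" "W \<subseteq> W'"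
  shows "induced_by_id (whole_module scale) W' (W +>\<^bsub>whole_module scale\<^esub> x) =
         W' +>\<^bsub>whole_module scale\<^esub> x"
proof -
  have cosets: "V +>\<^bsub>whole_module scale\<^esub> y = (\<lambda>v. v + y) ` V" for V y
    by (auto simp: a_r_coset_def r_coset_def whole_module_def)
  have shift: "(\<lambda>v. v + (w + x)) ` W' = (\<lambda>v. v + x) ` W'" if "w \<in> W" for w
  proof -
    have w: "w \<in> W'" using that assms(3) by blast
    have "v + (w + x) \<in> (\<lambda>v. v + x) ` W'" if "v \<in> W'" for v
      by (rule image_eqI[of _ _ "v + w"]) (simp_all add: add.assoc subspace_add assms(2) that w)
    moreover have "v + x \<in> (\<lambda>v. v + (w + x)) ` W'" if "v \<in> W'" for v
      by (rule image_eqI[of _ _ "v - w"]) (simp_all add: subspace_diff assms(2) that w)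
    ultimately show ?thesis by blast
  qed
  have "induced_by_id (whole_module scale) W' (W +>\<^bsub>whole_module scale\<^esub> x) =
        (\<Union>w\<in>W. (\<lambda>v. v + (w + x)) ` W')"
    by (simp add: induced_by_id_def cosets)
  also have "\<dots> = (\<lambda>v. v + x) ` W'"
    using shift subspace_0[OF assms(1)] by (simp only: SUP_cong[OF refl shift]) auto
  finally show ?thesis by (simp only: cosets)
qed

end

theory Submission
  imports Defs
begin

text \<open>
  Write \<open>\<partial>\<close> for \<open>del\<close> and \<open>\<delta>\<close> for \<open>delb\<close>. The bidegree parts of \<open>d\<^sup>2 = 0\<close> say that both square to zero and
  anticommute, so \<open>d dc\<close> is a nonzero multiple of \<open>\<partial>\<delta>\<close>. All four conditions are reduced, degree by
  degree, to two elementary statements about elements of the bicomplex.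

  \<^item> \<open>types_span k\<close>: every \<open>d\<close>-closed \<open>x\<close> of degree \<open>k\<close> has \<open>\<partial>x = \<partial>\<delta>u\<close> for some \<open>u\<close>. Replacing \<open>x\<close> by
    \<open>x - d u\<close>, this means that every class is a sum of classes of closed elements of pure bidegree.

  \<^item> \<open>types_independent k\<close>: if \<open>u\<close> has pure bidegree in degree \<open>k - 1\<close> and \<open>\<partial>\<delta>u = 0\<close>, then \<open>\<partial>u\<close> is
    \<open>d\<close>-exact. Such \<open>u\<close> give the relations \<open>[\<partial>u] + [\<delta>u] = 0\<close> between classes of pure bidegree, and all
    relations are generated by these; so this is directness of the sum of those classes.

  Truncating the primitive of the difference of two representatives shows that
  \<open>F p k \<inter> F_conj (k - p) k\<close> consists of the classes of closed elements of bidegree \<open>(p, k - p)\<close>, and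
  that \<open>F p k \<inter> F_conj (k + 1 - p) k\<close> consists of the classes \<open>[\<partial>u]\<close> with \<open>\<partial>\<delta>u = 0\<close> (lemmas
  \<open>hodge_reps_weight\<close> and \<open>hodge_reps_weight_Suc\<close>). Hence purity in degree \<open>k\<close> is the conjunction of the
  two statements (\<open>pure_Hodge_structure_iff\<close>); the equation \<open>F_tot k k = H\<^sup>k\<close> is the first one
  (\<open>F_tot_weight_iff\<close>); and \<open>F_tot (k + 1) k = 0\<close> is the second one (\<open>F_tot_weight_Suc_iff\<close>). For a bounded
  bicomplex \<open>F_tot\<close> is a finite, exhaustive and separated decreasing filtration, so these two equations
  say that the purity defect in degree \<open>k\<close> vanishes (\<open>pdef_deg_eq_0_iff\<close>).

  The sign change \<open>(-1)\<^sup>p\<close> on bidegree \<open>(p, q)\<close> interchanges \<open>d\<close> and \<open>dc\<close> up to a scalar. It translates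
  vanishing of \<open>H_urcorner (k + 1)\<close> into \<open>types_span k\<close>, and vanishing of \<open>H_llcorner (k - 1)\<close> into
  \<open>types_independent k\<close>. Finally, the obstruction groups are the kernel of \<open>\<phi>\<close> and the cokernel of \<open>\<psi>\<close>,
  while \<open>\<phi>\<close> is always onto and \<open>\<psi>\<close> always injective (\<open>phi_iso_iff\<close>, \<open>psi_iso_iff\<close>).
\<close>

section \<open>Quotients of subspaces\<close>

lemma whole_module_abelian_group: "abelian_group (whole_module s)"
proof (rule abelian_groupI)
  fix x assume "x \<in> carrier (whole_module s)"
  show "\<exists>y\<in>carrier (whole_module s). y \<oplus>\<^bsub>whole_module s\<^esub> x = \<zero>\<^bsub>whole_module s\<^esub>"
    by (rule bexI[of _ "- x"]) (auto simp: whole_module_def)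
qed (auto simp: whole_module_def algebra_simps)

lemma finsum_whole_module:
  "finite J \<Longrightarrow> finsum (whole_module s) f J = sum f J"
proof (induction J rule: finite_induct)
  interpret abelian_group "whole_module s" by (rule whole_module_abelian_group)
  case empty
  show ?case unfolding finsum_empty by (simp add: whole_module_def)
next
  interpret abelian_group "whole_module s" by (rule whole_module_abelian_group)
  case (insert j J)
  then have "finsum (whole_module s) f (insert j J) = f j \<oplus>\<^bsub>whole_module s\<^esub> finsum (whole_module s) f J"
    by (intro finsum_insert) (auto simp: whole_module_def)
  then show ?case using insert by (simp add: whole_module_def)
qed

lemma mem_sum_of_subspaces_iff:
  "X \<in> sum_of_subspaces M I N \<longleftrightarrow>
    (\<exists>f J. X = finsum M f J \<and> finite J \<and> J \<subseteq> I \<and> (\<forall>i\<in>J. f i \<in> N i))"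
  by (simp add: sum_of_subspaces_def Pi_iff)

locale subspace_pair = vector_space scale for scale :: "complex \<Rightarrow> 'a::ab_group_add \<Rightarrow> 'a" +
  fixes V W :: "'a set"
  assumes subspace_V: "subspace V" and subspace_W: "subspace W" and W_sub_V: "W \<subseteq> V"
begin

abbreviation coset :: "'a set \<Rightarrow> 'a \<Rightarrow> 'a set" where
  "coset U x \<equiv> U +>\<^bsub>whole_module scale\<^esub> x"

definition Q :: "(complex, 'a set) module" where
  "Q = quotient_module (whole_module scale) V W"

lemma coset_eq_image: "coset W x = (\<lambda>v. v + x) ` W"
  by (auto simp: a_r_coset_def r_coset_def whole_module_def)

lemma mem_coset_iff: "y \<in> coset W x \<longleftrightarrow> y - x \<in> W"
proof
  assume "y - x \<in> W"
  then show "y \<in> coset W x" unfolding coset_eq_image by (intro image_eqI[of _ _ "y - x"]) auto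
qed (auto simp: coset_eq_image)

text \<open>This equivalence turns statements about the record \<open>Q\<close> into statements about representatives in
  \<open>V\<close>.\<close>

lemma coset_eq_iff: "coset W x = coset W y \<longleftrightarrow> x - y \<in> W"
proof
  assume "coset W x = coset W y"
  moreover have "x \<in> coset W x" by (simp add: mem_coset_iff subspace_0 subspace_W)
  ultimately show "x - y \<in> W" by (simp add: mem_coset_iff)
next
  assume xy: "x - y \<in> W"
  have "z - x \<in> W \<longleftrightarrow> z - y \<in> W" for z
    using subspace_add[OF subspace_W _ xy, of "z - x"] subspace_diff[OF subspace_W _ xy, of "z - y"]
    by auto
  then show "coset W x = coset W y" by (auto simp: mem_coset_iff)
qed

lemma coset_zero: "coset W 0 = W"
  by (auto simp: mem_coset_iff)

lemma coset_eq_W_iff: "coset W x = W \<longleftrightarrow> x \<in> W"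
  using coset_eq_iff[of x 0] by (simp add: coset_zero)

lemma carrier_Q: "carrier Q = coset W ` V"
  by (simp add: Q_def quotient_module_def)

lemma coset_in_carrier_Q: "x \<in> V \<Longrightarrow> coset W x \<in> carrier Q"
  by (simp add: carrier_Q)

lemma zero_Q: "\<zero>\<^bsub>Q\<^esub> = W"
  by (simp add: Q_def quotient_module_def)

lemma add_Q: "coset W x \<oplus>\<^bsub>Q\<^esub> coset W y = coset W (x + y)"
proof -
  have "coset W x \<oplus>\<^bsub>Q\<^esub> coset W y = {u + v | u v. u \<in> coset W x \<and> v \<in> coset W y}"
    by (auto simp: Q_def quotient_module_def set_add_def set_mult_def whole_module_def)
  also have "\<dots> = coset W (x + y)"
  proof (rule Set.set_eqI, rule iffI)
    fix z assume "z \<in> {u + v | u v. u \<in> coset W x \<and> v \<in> coset W y}"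
    then obtain u v where z: "z = u + v" "u - x \<in> W" "v - y \<in> W" by (auto simp: mem_coset_iff)
    have eq: "z - (x + y) = (u - x) + (v - y)" using z(1) by (simp add: algebra_simps)
    show "z \<in> coset W (x + y)" unfolding mem_coset_iff eq by (rule subspace_add[OF subspace_W z(2,3)])
  next
    fix z assume "z \<in> coset W (x + y)"
    then have "z = (z - y) + y \<and> (z - y) \<in> coset W x \<and> y \<in> coset W y"
      by (auto simp: mem_coset_iff subspace_0 subspace_W algebra_simps)
    then show "z \<in> {u + v | u v. u \<in> coset W x \<and> v \<in> coset W y}" by blast
  qed
  finally show ?thesis .
qed

lemma smult_Q: "c \<odot>\<^bsub>Q\<^esub> coset W x = coset W (scale c x)"
proof -
  have "coset W (scale c y) = coset W (scale c x)" if "y \<in> coset W x" for y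
    using that subspace_scale[OF subspace_W, of "y - x" c]
    by (simp add: coset_eq_iff mem_coset_iff scale_right_diff_distrib)
  moreover have "x \<in> coset W x" by (simp add: mem_coset_iff subspace_0 subspace_W)
  moreover have "c \<odot>\<^bsub>Q\<^esub> coset W x = (\<Union>y\<in>coset W x. coset W (scale c y))"
    by (simp add: Q_def quotient_module_def whole_module_def)
  ultimately show ?thesis by blast
qed

lemma abelian_group_Q: "abelian_group Q"
proof (rule abelian_groupI)
  show "x \<oplus>\<^bsub>Q\<^esub> y \<in> carrier Q" if "x \<in> carrier Q" "y \<in> carrier Q" for x y
    using that subspace_add[OF subspace_V] by (auto simp: carrier_Q add_Q)
  show "\<zero>\<^bsub>Q\<^esub> \<in> carrier Q"
    using subspace_0[OF subspace_V] coset_zero by (auto simp: carrier_Q zero_Q)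
  show "\<zero>\<^bsub>Q\<^esub> \<oplus>\<^bsub>Q\<^esub> x = x" if "x \<in> carrier Q" for x
    using that add_Q[of 0] by (auto simp: carrier_Q zero_Q coset_zero)
  show "\<exists>y\<in>carrier Q. y \<oplus>\<^bsub>Q\<^esub> x = \<zero>\<^bsub>Q\<^esub>" if x: "x \<in> carrier Q" for x
  proof -
    obtain v where v: "v \<in> V" "x = coset W v" using x by (auto simp: carrier_Q)
    then have "coset W (- v) \<in> carrier Q" using subspace_neg[OF subspace_V] by (auto simp: carrier_Q)
    moreover have "coset W (- v) \<oplus>\<^bsub>Q\<^esub> x = \<zero>\<^bsub>Q\<^esub>" using v by (simp add: add_Q zero_Q coset_zero)
    ultimately show ?thesis by blast
  qed
qed (auto simp: carrier_Q add_Q algebra_simps)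

lemma finsum_Q:
  assumes "finite J" "\<And>j. j \<in> J \<Longrightarrow> g j \<in> V"
  shows "finsum Q (\<lambda>j. coset W (g j)) J = coset W (sum g J)"
  using assms
proof (induction J rule: finite_induct)
  interpret abelian_group Q by (rule abelian_group_Q)
  case empty
  then show ?case by (simp add: zero_Q coset_zero)
next
  interpret abelian_group Q by (rule abelian_group_Q)
  case (insert j J)
  have "finsum Q (\<lambda>j. coset W (g j)) (insert j J) =
      coset W (g j) \<oplus>\<^bsub>Q\<^esub> finsum Q (\<lambda>j. coset W (g j)) J"
    using insert by (intro finsum_insert) (auto simp: carrier_Q)
  then show ?case using insert by (simp add: add_Q)
qed

lemma zero_module_Q: "zero_module Q \<longleftrightarrow> V \<subseteq> W"
proof -
  have "zero_module Q \<longleftrightarrow> (\<forall>x\<in>V. coset W x = W)"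
    using subspace_0[OF subspace_V] coset_zero by (auto simp: zero_module_def carrier_Q zero_Q)
  then show ?thesis by (auto simp: coset_eq_W_iff)
qed

text \<open>Choosing representatives turns a finite sum of classes into the class of a finite sum. For the
  inclusion from right to left, an element of the span is written as a sum with exactly one
  summand from each \<open>G i\<close>, by induction over the span.\<close>

lemma sum_of_subspaces_Q:
  assumes sub: "\<And>i. i \<in> I \<Longrightarrow> subspace (G i)" and GV: "\<And>i. i \<in> I \<Longrightarrow> G i \<subseteq> V"
  shows "sum_of_subspaces Q I (\<lambda>i. coset W ` G i) = coset W ` span (\<Union>i\<in>I. G i)"
proof (rule Set.set_eqI, rule iffI)
  interpret abelian_group Q by (rule abelian_group_Q)
  fix X assume "X \<in> sum_of_subspaces Q I (\<lambda>i. coset W ` G i)"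
  then obtain f J where J: "finite J" "J \<subseteq> I" "\<And>i. i \<in> J \<Longrightarrow> f i \<in> coset W ` G i" "X = finsum Q f J"
    by (simp add: mem_sum_of_subspaces_iff) blast
  then have "\<forall>i\<in>J. \<exists>g. g \<in> G i \<and> f i = coset W g" by blast
  then obtain g where g: "\<And>i. i \<in> J \<Longrightarrow> g i \<in> G i" "\<And>i. i \<in> J \<Longrightarrow> f i = coset W (g i)" by metis
  have "finsum Q f J = finsum Q (\<lambda>i. coset W (g i)) J"
    using g J by (intro finsum_cong') (auto intro!: coset_in_carrier_Q subsetD[OF GV])
  also have "\<dots> = coset W (sum g J)" using g J by (intro finsum_Q) (auto intro!: subsetD[OF GV])
  finally have X: "X = coset W (sum g J)" using J by simp
  have "sum g J \<in> span (\<Union>i\<in>I. G i)"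
    using g J by (intro span_sum span_base) blast
  then show "X \<in> coset W ` span (\<Union>i\<in>I. G i)" using X by auto
next
  interpret abelian_group Q by (rule abelian_group_Q)
  define P where "P x \<longleftrightarrow> (\<exists>J g. finite J \<and> J \<subseteq> I \<and> (\<forall>i\<in>I. g i \<in> G i) \<and> (\<forall>i. i \<notin> J \<longrightarrow> g i = 0) \<and> x = sum g J)" for x
  fix X assume "X \<in> coset W ` span (\<Union>i\<in>I. G i)"
  then obtain x where x: "x \<in> span (\<Union>i\<in>I. G i)" "X = coset W x" by auto
  have "P x" using x(1)
  proof (induction rule: span_induct_alt)
    case base
    show ?case unfolding P_def by (rule exI[of _ "{}"], rule exI[of _ "\<lambda>_. 0"]) (auto simp: subspace_0 sub)
  next
    case (step c u y)
    then obtain J g where Jg: "finite J" "J \<subseteq> I" "\<And>i. i \<in> I \<Longrightarrow> g i \<in> G i" "\<And>i. i \<notin> J \<Longrightarrow> g i = 0" "y = sum g J"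
      unfolding P_def by auto
    obtain i where i: "i \<in> I" "u \<in> G i" using step by auto
    \<comment> \<open>The new term is merged into the summand with the same index.\<close>
    define h where "h j = (if j = i then scale c u else 0) + g j" for j
    have "sum h (insert i J) = scale c u + sum g (insert i J)"
      unfolding h_def sum.distrib using Jg(1) by (subst sum.delta) auto
    also have "sum g (insert i J) = sum g J"
      using Jg by (intro sum.mono_neutral_right) auto
    finally have "scale c u + y = sum h (insert i J)" using Jg by simp
    moreover have "h j \<in> G j" if "j \<in> I" for j
      using that i Jg by (auto simp: h_def intro!: subspace_add subspace_scale sub)
    ultimately show ?case unfolding P_def using Jg i
      by (intro exI[of _ "insert i J"] exI[of _ h]) (auto simp: h_def)
  qed
  then obtain J g where Jg: "finite J" "J \<subseteq> I" "\<And>i. i \<in> I \<Longrightarrow> g i \<in> G i" "x = sum g J"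
    unfolding P_def by auto
  then have "X = finsum Q (\<lambda>i. coset W (g i)) J" using x GV by (subst finsum_Q) (auto intro!: subsetD[OF GV])
  then show "X \<in> sum_of_subspaces Q I (\<lambda>i. coset W ` G i)"
    using Jg unfolding sum_of_subspaces_def by (intro CollectI exI[of _ "\<lambda>i. coset W (g i)"] exI[of _ J]) auto
qed

text \<open>The unique-expansion form of directness, split into existence of an expansion and
  independence. The independence condition is about representatives: if a sum of them lies in
  \<open>W\<close>, then so does every summand. It follows from uniqueness by comparison with the expansion of
  the zero class, and it gives uniqueness by subtracting two expansions.\<close>

lemma direct_sum_decomposition_Q:
  fixes G :: "'i \<Rightarrow> 'a set"
  assumes sub: "\<And>i. subspace (G i)" and GV: "\<And>i. G i \<subseteq> V"
  shows "direct_sum_decomposition Q UNIV (\<lambda>i. coset W ` G i) \<longleftrightarrow>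
    sum_of_subspaces Q UNIV (\<lambda>i. coset W ` G i) = carrier Q \<and>
    (\<forall>J g. finite J \<and> (\<forall>i\<in>J. g i \<in> G i) \<and> sum g J \<in> W \<longrightarrow> (\<forall>i\<in>J. g i \<in> W))"
    (is "?D \<longleftrightarrow> ?S \<and> ?I")
proof -
  interpret abelian_group Q by (rule abelian_group_Q)
  define supp where "supp f = {i. f i \<noteq> W}" for f :: "'i \<Rightarrow> 'a set"
  define dec where "dec x f \<longleftrightarrow> (\<forall>i. f i \<in> coset W ` G i) \<and> finite (supp f) \<and> x = finsum Q f (supp f)" for x f
  have D: "?D \<longleftrightarrow> (\<forall>x\<in>carrier Q. \<exists>!f. dec x f)"
  proof -
    have "coset W ` G i \<subseteq> carrier Q" for i using GV by (auto simp: carrier_Q)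
    then show ?thesis
      unfolding direct_sum_decomposition_def dec_def supp_def zero_Q by (simp add: PiE_iff)
  qed
  have lift: "\<exists>g. \<forall>i. g i \<in> G i \<and> f i = coset W (g i)" if "\<forall>i. f i \<in> coset W ` G i" for f
  proof (rule choice, rule allI)
    fix i show "\<exists>v. v \<in> G i \<and> f i = coset W v" using that by blast
  qed
  have fs: "finsum Q f (supp f) = coset W (sum g J)"
    if "\<And>i. g i \<in> G i" "\<And>i. f i = coset W (g i)" "finite J" "supp f \<subseteq> J" for f g J
  proof -
    have "finsum Q f (supp f) = finsum Q f J"
      using that GV by (intro add.finprod_mono_neutral_cong_left)
        (auto simp: zero_Q supp_def intro!: coset_in_carrier_Q subsetD[OF GV])
    also have "\<dots> = finsum Q (\<lambda>i. coset W (g i)) J" using that GV by (intro finsum_cong') (auto intro!: coset_in_carrier_Q subsetD[OF GV])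
    also have "\<dots> = coset W (sum g J)" using that by (intro finsum_Q) (auto intro!: subsetD[OF GV])
    finally show ?thesis .
  qed
  have ex: "X \<in> sum_of_subspaces Q UNIV (\<lambda>i. coset W ` G i)" if "dec X f" for X f
    using that unfolding sum_of_subspaces_def dec_def by blast
  have sum_dec: "\<exists>f. dec X f" if X: "X \<in> sum_of_subspaces Q UNIV (\<lambda>i. coset W ` G i)" for X
  proof -
    obtain f J where J: "X = finsum Q f J" "finite J" "\<And>i. i \<in> J \<Longrightarrow> f i \<in> coset W ` G i"
      using X unfolding mem_sum_of_subspaces_iff by blast
    define f' where "f' i = (if i \<in> J then f i else W)" for i
    have WG: "W \<in> coset W ` G i" for i using coset_zero subspace_0[OF sub[of i]] by (metis imageI)
    have f'G: "f' i \<in> coset W ` G i" for i using J WG by (auto simp: f'_def)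
    have sJ: "supp f' \<subseteq> J" by (auto simp: supp_def f'_def)
    have fC: "f i \<in> carrier Q" if "i \<in> J" for i using J(3)[OF that] GV by (auto simp: carrier_Q)
    have "finsum Q f' (supp f') = finsum Q f J"
      using J sJ fC by (intro add.finprod_mono_neutral_cong_left) (auto simp: zero_Q supp_def f'_def)
    then have "dec X f'" using f'G J finite_subset[OF sJ] by (auto simp: dec_def)
    then show ?thesis by blast
  qed
  have sub_carrier: "sum_of_subspaces Q UNIV (\<lambda>i. coset W ` G i) \<subseteq> carrier Q"
    using span_minimal[of "\<Union>(range G)" V] subspace_V GV
    by (subst sum_of_subspaces_Q) (auto simp: sub carrier_Q)
  have S: "?S \<longleftrightarrow> (\<forall>x\<in>carrier Q. \<exists>f. dec x f)" using ex sum_dec sub_carrier by blast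
  show ?thesis
  proof
    assume L: ?D
    have ?I
    proof (intro allI impI ballI)
      fix J g i assume A: "finite J \<and> (\<forall>i\<in>J. g i \<in> G i) \<and> sum g J \<in> W" and i: "i \<in> J"
      \<comment> \<open>Extended by zero, the family is an expansion of the zero class.\<close>
      define g' where "g' j = (if j \<in> J then g j else 0)" for j
      have g': "g' j \<in> G j" for j using A subspace_0[OF sub] by (auto simp: g'_def)
      have sJ: "supp (\<lambda>j. coset W (g' j)) \<subseteq> J" by (auto simp: supp_def g'_def coset_zero)
      have "sum g' J = sum g J" by (simp add: g'_def)
      then have "finsum Q (\<lambda>j. coset W (g' j)) (supp (\<lambda>j. coset W (g' j))) = W"
        using fs[of g' "\<lambda>j. coset W (g' j)" J] g' sJ A by (simp add: coset_eq_W_iff)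
      then have 1: "dec W (\<lambda>j. coset W (g' j))" using g' finite_subset[OF sJ] A by (auto simp: dec_def)
      have 0: "coset W 0 \<in> coset W ` G j" for j using subspace_0[OF sub] by blast
      have s0: "supp (\<lambda>_. W) = {}" by (simp add: supp_def)
      have 2: "dec W (\<lambda>_. W)" using 0 by (simp add: dec_def s0 zero_Q coset_zero)
      have "W \<in> carrier Q" using zero_closed by (simp add: zero_Q)
      then have "(\<lambda>j. coset W (g' j)) = (\<lambda>_. W)" using L 1 2 unfolding D by blast
      then have "coset W (g' i) = W" by (rule fun_cong)
      then show "g i \<in> W" using i by (simp add: g'_def coset_eq_W_iff)
    qed
    moreover have ?S unfolding S using L unfolding D by blast
    ultimately show "?S \<and> ?I" by blast
  next
    assume R: "?S \<and> ?I"
    have "f = f'" if ff': "dec x f" "dec x f'" for x f f'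
    proof
      fix i
      obtain g where g: "\<And>i. g i \<in> G i" "\<And>i. f i = coset W (g i)" using lift ff'(1) unfolding dec_def by metis
      obtain g' where g': "\<And>i. g' i \<in> G i" "\<And>i. f' i = coset W (g' i)" using lift ff'(2) unfolding dec_def by metis
      define J where "J = insert i (supp f \<union> supp f')"
      have J: "finite J" "supp f \<subseteq> J" "supp f' \<subseteq> J" using that by (auto simp: J_def dec_def)
      have "coset W (sum g J) = coset W (sum g' J)"
        using fs[of g f J] fs[of g' f' J] g g' J that by (simp add: dec_def)
      then have "sum (\<lambda>i. g i - g' i) J \<in> W" by (simp add: coset_eq_iff sum_subtractf)
      moreover have "\<forall>j\<in>J. g j - g' j \<in> G j" using subspace_diff[OF sub] g g' by blast
      ultimately have "\<forall>j\<in>J. g j - g' j \<in> W"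
        using R[THEN conjunct2, THEN spec, of J, THEN spec, of "\<lambda>j. g j - g' j"] J(1) by blast
      then have "g i - g' i \<in> W" by (simp add: J_def)
      then show "f i = f' i" by (simp add: g g' coset_eq_iff)
    qed
    then show ?D unfolding D using R S by blast
  qed
qed

end

text \<open>The map \<open>V / W \<rightarrow> V' / W'\<close> has kernel \<open>(V \<inter> W') / W\<close> and image \<open>(V + W') / W'\<close>, and it is always
  linear; so it is an isomorphism exactly when the kernel is zero and \<open>V' \<subseteq> V + W'\<close>.\<close>

lemma linear_iso_induced_by_id:
  assumes 1: "subspace_pair s V W" and 2: "subspace_pair s V' W'"
    and VV': "V \<subseteq> V'" and WW': "W \<subseteq> W'"
  shows "linear_iso (quotient_module (whole_module s) V W)
      (quotient_module (whole_module s) V' W') (induced_by_id (whole_module s) W') \<longleftrightarrow>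
    V \<inter> W' \<subseteq> W \<and> (\<forall>x\<in>V'. \<exists>y\<in>V. x - y \<in> W')"
proof -
  interpret P: subspace_pair s V W by (rule 1)
  interpret P': subspace_pair s V' W' by (rule 2)
  define h where "h = induced_by_id (whole_module s) W'"
  have h: "h (P.coset W x) = P.coset W' x" for x
  proof -
    have "P.coset W' y = P.coset W' x" if "y \<in> P.coset W x" for y
      using that WW' by (auto simp: P.mem_coset_iff P'.coset_eq_iff)
    moreover have "x \<in> P.coset W x" by (simp add: P.mem_coset_iff P.subspace_0 P.subspace_W)
    ultimately show ?thesis unfolding h_def induced_by_id_def by blast
  qed
  have "h \<in> hom (add_monoid P.Q) (add_monoid P'.Q)"
    using VV' by (auto simp: hom_def P.carrier_Q P'.carrier_Q P.add_Q P'.add_Q h)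
  moreover have "\<forall>c. \<forall>x\<in>carrier P.Q. h (c \<odot>\<^bsub>P.Q\<^esub> x) = c \<odot>\<^bsub>P'.Q\<^esub> h x"
    by (auto simp: P.carrier_Q P.smult_Q P'.smult_Q h)
  ultimately have iso: "linear_iso P.Q P'.Q h \<longleftrightarrow> bij_betw h (P.coset W ` V) (P.coset W' ` V')"
    by (auto simp: linear_iso_def iso_def P.carrier_Q P'.carrier_Q)
  have "inj_on h (P.coset W ` V) \<longleftrightarrow> (\<forall>x\<in>V. \<forall>y\<in>V. x - y \<in> W' \<longrightarrow> x - y \<in> W)"
    by (auto simp: inj_on_def h P.coset_eq_iff P'.coset_eq_iff)
  also have "\<dots> \<longleftrightarrow> V \<inter> W' \<subseteq> W"
    using P.subspace_0[OF P.subspace_V] P.subspace_diff[OF P.subspace_V]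
    by (auto simp: subset_iff) (metis diff_zero)
  finally have inj: "inj_on h (P.coset W ` V) \<longleftrightarrow> V \<inter> W' \<subseteq> W" .
  have "h ` P.coset W ` V = P.coset W' ` V" by (auto simp: h image_image)
  then have "h ` P.coset W ` V = P.coset W' ` V' \<longleftrightarrow> (\<forall>x\<in>V'. P.coset W' x \<in> P.coset W' ` V)"
    using VV' by auto
  also have "\<dots> \<longleftrightarrow> (\<forall>x\<in>V'. \<exists>y\<in>V. x - y \<in> W')"
    by (auto simp: image_iff P'.coset_eq_iff)
  finally show ?thesis using iso inj by (simp add: bij_betw_def P.Q_def P'.Q_def h_def)
qed

section \<open>Components of a bigraded vector space\<close>

context bicomplex
begin

text \<open>The grading axiom in terms of ordinary sums in the ambient additive group.\<close>

lemma ex1_decomposition: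
  "\<exists>!f. (\<forall>p q. f (p, q) \<in> A p q) \<and> finite {i. f i \<noteq> 0} \<and> x = sum f {i. f i \<noteq> 0}"
proof -
  have z: "\<zero>\<^bsub>whole_module scale\<^esub> = 0" and c: "x \<in> carrier (whole_module scale)"
    by (auto simp: whole_module_def)
  have "\<exists>!f. f \<in> (\<Pi>\<^sub>E i\<in>UNIV. (\<lambda>(p, q). A p q) i) \<and> finite {i\<in>UNIV. f i \<noteq> 0} \<and>
      x = finsum (whole_module scale) f {i\<in>UNIV. f i \<noteq> 0}"
    using grading c unfolding direct_sum_decomposition_def z by blast
  moreover have "f \<in> (\<Pi>\<^sub>E i\<in>UNIV. (\<lambda>(p, q). A p q) i) \<and> finite {i\<in>UNIV. f i \<noteq> 0} \<and>
      x = finsum (whole_module scale) f {i\<in>UNIV. f i \<noteq> 0} \<longleftrightarrow>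
    (\<forall>p q. f (p, q) \<in> A p q) \<and> finite {i. f i \<noteq> 0} \<and> x = sum f {i. f i \<noteq> 0}" for f
    by (auto simp: PiE_iff finsum_whole_module)
  ultimately show ?thesis by simp
qed

definition decomposition :: "'a \<Rightarrow> int \<times> int \<Rightarrow> 'a" where
  "decomposition x = (THE f. (\<forall>p q. f (p, q) \<in> A p q) \<and> finite {i. f i \<noteq> 0} \<and> x = sum f {i. f i \<noteq> 0})"

definition component :: "int \<Rightarrow> int \<Rightarrow> 'a \<Rightarrow> 'a" where
  "component p q x = decomposition x (p, q)"

lemma component_in: "component p q x \<in> A p q"
  and finite_component: "finite {(p, q). component p q x \<noteq> 0}"
  and sum_component_support: "x = (\<Sum>(p, q)\<in>{(p, q). component p q x \<noteq> 0}. component p q x)"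
  using theI'[OF ex1_decomposition[of x]]
  unfolding decomposition_def[symmetric] component_def by (simp_all add: case_prod_unfold)

lemma zero_in_A: "0 \<in> A p q"
  using subspace_A subspace_0 by blast

text \<open>The family \<open>g\<close> may be summed over any finite set containing its support. This freedom is what makes
  the components additive: two elements are expanded over a common index set.\<close>

lemma component_unique:
  assumes g: "\<And>p q. g p q \<in> A p q" and K: "finite K" "\<And>p q. (p, q) \<notin> K \<Longrightarrow> g p q = 0"
    and x: "x = (\<Sum>(p, q)\<in>K. g p q)"
  shows "component p q x = g p q"
proof -
  define f where "f = (\<lambda>(p, q). g p q)"
  have sub: "{i. f i \<noteq> 0} \<subseteq> K" using K(2) by (auto simp: f_def)
  have "x = sum f {i. f i \<noteq> 0}"
    unfolding x f_def[symmetric] using K(1) sub by (intro sum.mono_neutral_right) auto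
  then have "decomposition x = f"
    unfolding decomposition_def using g finite_subset[OF sub K(1)]
    by (intro the1_equality[OF ex1_decomposition]) (auto simp: f_def)
  then show ?thesis by (simp add: component_def f_def)
qed

lemma sum_component:
  assumes "finite K" "\<And>p q. (p, q) \<notin> K \<Longrightarrow> component p q x = 0"
  shows "x = (\<Sum>(p, q)\<in>K. component p q x)"
  by (subst sum_component_support[of x], rule sum.mono_neutral_left) (use assms in auto)

lemma component_add: "component p q (x + y) = component p q x + component p q y"
proof (rule component_unique)
  define K where "K = {(p, q). component p q x \<noteq> 0} \<union> {(p, q). component p q y \<noteq> 0}"
  show K: "finite K" by (simp add: K_def finite_component)
  show "component p q x + component p q y \<in> A p q" for p q
    using subspace_add[OF subspace_A component_in component_in] .
  show "component p q x + component p q y = 0" if "(p, q) \<notin> K" for p q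
    using that by (simp add: K_def)
  have "x = (\<Sum>(p, q)\<in>K. component p q x)" "y = (\<Sum>(p, q)\<in>K. component p q y)"
    by (rule sum_component[OF K], simp add: K_def)+
  then show "x + y = (\<Sum>(p, q)\<in>K. component p q x + component p q y)"
    by (simp add: sum.distrib case_prod_unfold)
qed

lemma component_scale: "component p q (scale c x) = scale c (component p q x)"
proof (rule component_unique)
  define K where "K = {(p, q). component p q x \<noteq> 0}"
  show K: "finite K" by (simp add: K_def finite_component)
  show "scale c (component p q x) \<in> A p q" for p q
    using subspace_scale[OF subspace_A component_in] .
  show "scale c (component p q x) = 0" if "(p, q) \<notin> K" for p q
    using that by (simp add: K_def)
  have "x = (\<Sum>(p, q)\<in>K. component p q x)" by (rule sum_component[OF K], simp add: K_def)
  then show "scale c x = (\<Sum>(p, q)\<in>K. scale c (component p q x))"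
    using scale_sum_right[of c "\<lambda>(p, q). component p q x" K] by (simp add: case_prod_unfold)
qed

lemma component_zero: "component p q 0 = 0"
  using component_scale[of p q 0 0] by simp

lemma component_minus: "component p q (- x) = - component p q x"
  using component_scale[of p q "- 1" x] by simp

lemma component_diff: "component p q (x - y) = component p q x - component p q y"
  using component_add[of p q x "- y"] by (simp add: component_minus)

lemma component_sum: "component p q (sum f I) = (\<Sum>i\<in>I. component p q (f i))"
  by (induction I rule: infinite_finite_induct) (simp_all add: component_zero component_add)

lemmas component_linear =
  component_add component_scale component_zero component_minus component_diff component_sum

lemma component_homogeneous:
  assumes "x \<in> A p q"
  shows "component p' q' x = (if p' = p \<and> q' = q then x else 0)"
  by (rule component_unique[where K = "{(p, q)}" and g = "\<lambda>p' q'. if p' = p \<and> q' = q then x else 0"])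
    (use assms zero_in_A in auto)

lemma component_component:
  "component p q (component p' q' x) = (if p = p' \<and> q = q' then component p q x else 0)"
  using component_homogeneous[OF component_in] by simp

lemma component_eqI: "(\<And>p q. component p q x = component p q y) \<Longrightarrow> x = y"
  using sum_component_support[of x] sum_component_support[of y] by simp

text \<open>An additive property of all homogeneous elements holds for all elements; identities between
  linear maps are checked on homogeneous elements in this way.\<close>

lemma homogeneous_induct [case_names zero add homogeneous]:
  assumes "P 0" "\<And>x y. P x \<Longrightarrow> P y \<Longrightarrow> P (x + y)" "\<And>p q x. x \<in> A p q \<Longrightarrow> P x"
  shows "P x"
proof -
  have "P (\<Sum>(p, q)\<in>K. component p q x)" for K
    by (induction K rule: infinite_finite_induct) (auto intro: assms component_in)
  then show ?thesis using sum_component_support[of x] by metis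
qed

text \<open>Projection onto the sum of the \<open>A p q\<close> with \<open>(p, q) \<in> S\<close>.\<close>

definition truncate :: "(int \<times> int) set \<Rightarrow> 'a \<Rightarrow> 'a" where
  "truncate S x = (\<Sum>(p, q)\<in>{(p, q). component p q x \<noteq> 0} \<inter> S. component p q x)"

lemma component_truncate: "component p q (truncate S x) = (if (p, q) \<in> S then component p q x else 0)"
  by (rule component_unique[where K = "{(p, q). component p q x \<noteq> 0} \<inter> S"
        and g = "\<lambda>p q. if (p, q) \<in> S then component p q x else 0"])
    (auto simp: component_in zero_in_A finite_component truncate_def intro!: sum.cong)

text \<open>The total degree parts and both filtrations are spans of pieces \<open>A p q\<close>; membership in them is
  thereby reduced to vanishing of components.\<close>

lemma mem_span_homogeneous_iff:
  "x \<in> span (\<Union>i\<in>I. A (f i) (g i)) \<longleftrightarrow>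
    (\<forall>p q. component p q x \<noteq> 0 \<longrightarrow> (\<exists>i\<in>I. p = f i \<and> q = g i))"
proof
  assume "x \<in> span (\<Union>i\<in>I. A (f i) (g i))"
  then show "\<forall>p q. component p q x \<noteq> 0 \<longrightarrow> (\<exists>i\<in>I. p = f i \<and> q = g i)"
  proof (induction rule: span_induct_alt)
    case (step c y z)
    then obtain i where "i \<in> I" "y \<in> A (f i) (g i)" by auto
    then show ?case using step
      by (auto simp: component_linear component_homogeneous split: if_splits)
  qed (simp add: component_zero)
next
  assume *: "\<forall>p q. component p q x \<noteq> 0 \<longrightarrow> (\<exists>i\<in>I. p = f i \<and> q = g i)"
  have "(\<Sum>(p, q)\<in>{(p, q). component p q x \<noteq> 0}. component p q x) \<in> span (\<Union>i\<in>I. A (f i) (g i))"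
  proof (rule span_sum)
    fix pq assume "pq \<in> {(p, q). component p q x \<noteq> 0}"
    then obtain p q where pq: "pq = (p, q)" "component p q x \<noteq> 0" by auto
    then obtain i where "i \<in> I" "p = f i" "q = g i" using * by blast
    then show "(case pq of (p, q) \<Rightarrow> component p q x) \<in> span (\<Union>i\<in>I. A (f i) (g i))"
      using component_in[of p q x] pq(1) by (auto intro!: span_base)
  qed
  then show "x \<in> span (\<Union>i\<in>I. A (f i) (g i))" using sum_component_support[of x] by simp
qed

lemma mem_total_iff: "x \<in> total k \<longleftrightarrow> (\<forall>p q. p + q \<noteq> k \<longrightarrow> component p q x = 0)"
  unfolding total_def mem_span_homogeneous_iff
  by (auto simp: algebra_simps)

lemma mem_Fil_iff:
  "x \<in> Fil p k \<longleftrightarrow> x \<in> total k \<and> (\<forall>r s. r < p \<longrightarrow> component r s x = 0)"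
  unfolding Fil_def mem_span_homogeneous_iff mem_total_iff by force

lemma mem_Fil_conj_iff:
  "x \<in> Fil_conj q k \<longleftrightarrow> x \<in> total k \<and> (\<forall>r s. s < q \<longrightarrow> component r s x = 0)"
  unfolding Fil_conj_def mem_span_homogeneous_iff mem_total_iff by force

lemma truncate_in_total: "truncate {(p, q). p + q = k} x \<in> total k"
  by (auto simp: mem_total_iff component_truncate)

lemma A_sub_total: "x \<in> A p q \<Longrightarrow> p + q = k \<Longrightarrow> x \<in> total k"
  by (auto simp: mem_total_iff component_homogeneous)

lemma subspace_total: "subspace (total k)"
  by (simp add: total_def)

section \<open>The differentials\<close>

lemmas linear_del' = linear_del[THEN Vector_Spaces.linear.axioms(3)]
lemmas linear_delb' = linear_delb[THEN Vector_Spaces.linear.axioms(3)]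

lemmas del_linear =
  module_hom.add[OF linear_del'] module_hom.scale[OF linear_del'] module_hom.zero[OF linear_del']
  module_hom.neg[OF linear_del'] module_hom.diff[OF linear_del'] module_hom.sum[OF linear_del']

lemmas delb_linear =
  module_hom.add[OF linear_delb'] module_hom.scale[OF linear_delb'] module_hom.zero[OF linear_delb']
  module_hom.neg[OF linear_delb'] module_hom.diff[OF linear_delb'] module_hom.sum[OF linear_delb']

lemma del_in: "x \<in> A p q \<Longrightarrow> del x \<in> A (p + 1) q"
  using del_bidegree by blast

lemma delb_in: "x \<in> A p q \<Longrightarrow> delb x \<in> A p (q + 1)"
  using delb_bidegree by blast

lemma component_del: "component p q (del x) = del (component (p - 1) q x)"
proof (induction x rule: homogeneous_induct)
  case (homogeneous r s x)
  then show ?case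
    by (auto simp: component_homogeneous[OF homogeneous] component_homogeneous[OF del_in[OF homogeneous]] del_linear)
qed (simp_all add: del_linear component_linear)

lemma component_delb: "component p q (delb x) = delb (component p (q - 1) x)"
proof (induction x rule: homogeneous_induct)
  case (homogeneous r s x)
  then show ?case
    by (auto simp: component_homogeneous[OF homogeneous] component_homogeneous[OF delb_in[OF homogeneous]] delb_linear)
qed (simp_all add: delb_linear component_linear)

text \<open>The three bidegree parts of \<open>d\<^sup>2 = 0\<close>.\<close>

lemma del_del: "del (del x) = 0"
  and delb_delb: "delb (delb x) = 0"
  and delb_del: "delb (del x) = - del (delb x)"
proof -
  have "del (del x) = 0 \<and> delb (delb x) = 0 \<and> delb (del x) = - del (delb x)"
  proof (induction x rule: homogeneous_induct)
    case (homogeneous p q x)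
    have c: "component r s (del (del x) + del (delb x) + (delb (del x) + delb (delb x))) = 0" for r s
      using d_squared[of x] by (simp add: del_linear delb_linear component_zero)
    note h = component_homogeneous[OF del_in[OF del_in[OF homogeneous]]]
      component_homogeneous[OF del_in[OF delb_in[OF homogeneous]]]
      component_homogeneous[OF delb_in[OF del_in[OF homogeneous]]]
      component_homogeneous[OF delb_in[OF delb_in[OF homogeneous]]]
    show ?case
      using c[of "p + 2" q] c[of "p + 1" "q + 1"] c[of p "q + 2"]
      by (simp add: component_linear h eq_neg_iff_add_eq_0 add.commute)
  qed (auto simp: del_linear delb_linear)
  then show "del (del x) = 0" "delb (delb x) = 0" "delb (del x) = - del (delb x)" by auto
qed

lemma d_linear: "d (x + y) = d x + d y" "d (scale c x) = scale c (d x)" "d 0 = 0" "d (- x) = - d x"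
  "d (x - y) = d x - d y" "d (sum f I) = (\<Sum>i\<in>I. d (f i))"
  by (simp_all add: d_def del_linear delb_linear scale_right_distrib sum.distrib)

lemma dc_linear: "dc (x + y) = dc x + dc y" "dc (scale c x) = scale c (dc x)" "dc 0 = 0" "dc (- x) = - dc x"
  "dc (x - y) = dc x - dc y"
  by (simp_all add: dc_def del_linear delb_linear scale_right_distrib scale_right_diff_distrib algebra_simps)

lemma d_d: "d (d x) = 0"
  by (simp add: d_def d_squared)

lemma dc_dc: "dc (dc x) = 0"
  by (simp add: dc_def del_linear delb_linear del_del delb_delb delb_del)

lemma d_dc: "d (dc x) = scale (2 * \<i>) (del (delb x))"
proof -
  have "d (dc x) = scale \<i> (del (delb x) + del (delb x))"
    by (simp add: d_def dc_def del_linear delb_linear del_del delb_delb delb_del scale_right_diff_distrib scale_right_distrib)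
  also have "\<dots> = scale (2 * \<i>) (del (delb x))"
    by (simp add: scale_right_distrib flip: scale_left_distrib)
  finally show ?thesis .
qed

lemma dc_d: "dc (d x) = - d (dc x)"
  by (simp add: d_def dc_def del_linear delb_linear del_del delb_delb delb_del scale_right_diff_distrib scale_right_distrib)

lemma component_d: "component p q (d x) = del (component (p - 1) q x) + delb (component p (q - 1) x)"
  by (simp add: d_def component_linear component_del component_delb)

lemma d_in_total: "x \<in> total k \<Longrightarrow> d x \<in> total (k + 1)"
  by (simp add: mem_total_iff component_d del_linear delb_linear)

lemma truncate_Suc_del: "truncate {(p, q). p + q = k + 1} (del x) = del (truncate {(p, q). p + q = k} x)"
  by (rule component_eqI) (simp add: component_truncate component_del del_linear)

lemma truncate_Suc_delb: "truncate {(p, q). p + q = k + 1} (delb x) = delb (truncate {(p, q). p + q = k} x)"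
  by (rule component_eqI) (simp add: component_truncate component_delb delb_linear)

lemma truncate_add: "truncate S (x + y) = truncate S x + truncate S y"
  by (rule component_eqI) (simp add: component_truncate component_linear)

lemma truncate_id: "x \<in> total k \<Longrightarrow> truncate {(p, q). p + q = k} x = x"
  by (rule component_eqI) (auto simp: component_truncate mem_total_iff)

text \<open>The part of a primitive in degree \<open>k - 1\<close> is again a primitive, because \<open>d\<close> has total degree \<open>1\<close>.\<close>

lemma Im_d_total:
  assumes "x \<in> Im_d" "x \<in> total k"
  obtains u where "u \<in> total (k - 1)" "x = d u"
proof -
  obtain v where v: "x = d v" using assms(1) by (auto simp: Im_d_def)
  have "x = truncate {(p, q). p + q = k} (d v)" using assms(2) v truncate_id by simp
  also have "\<dots> = d (truncate {(p, q). p + q = k - 1} v)"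
    using truncate_Suc_del[of "k - 1" v] truncate_Suc_delb[of "k - 1" v]
    by (simp add: d_def truncate_add)
  finally show ?thesis using that[of "truncate {(p, q). p + q = k - 1} v"] truncate_in_total by blast
qed


section \<open>The maps from Bott-Chern and to Aeppli cohomology\<close>

lemma subspace_Ker_d: "subspace Ker_d"
  by (auto intro!: subspaceI simp: Ker_d_def d_linear)

lemma subspace_Ker_dc: "subspace Ker_dc"
  by (auto intro!: subspaceI simp: Ker_dc_def dc_linear)

lemma subspace_Ker_ddc: "subspace Ker_ddc"
  by (auto intro!: subspaceI simp: Ker_ddc_def d_linear dc_linear)

lemma module_hom_d: "module_hom scale scale d"
  and module_hom_dc: "module_hom scale scale dc"
  by (auto intro!: module_hom.intro module_hom_axioms.intro module_axioms simp: d_linear dc_linear)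

lemmas subspace_d_image = module_hom.subspace_image[OF module_hom_d]
lemmas subspace_dc_image = module_hom.subspace_image[OF module_hom_dc]
lemmas subspace_d_vimage = module_hom.subspace_vimage[OF module_hom_d]

lemma subspace_Im_d: "subspace Im_d"
  unfolding Im_d_def by (intro subspace_d_image) simp

lemma subspace_Im_dc: "subspace Im_dc"
  unfolding Im_dc_def by (intro subspace_dc_image) simp

lemma subspace_Im_ddc: "subspace Im_ddc"
proof -
  have "Im_ddc = d ` Im_dc" by (auto simp: Im_ddc_def Im_dc_def)
  then show ?thesis by (simp add: subspace_d_image subspace_Im_dc)
qed

lemma subspace_Im_d_plus_Im_dc: "subspace Im_d_plus_Im_dc"
  unfolding Im_d_plus_Im_dc_def by (rule subspace_sums[OF subspace_Im_d subspace_Im_dc])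

lemma Im_ddc_sub: "Im_ddc \<subseteq> d ` Ker_dc"
  by (auto simp: Im_ddc_def Ker_dc_def dc_dc)

lemma d_Ker_dc_sub: "d ` Ker_dc \<subseteq> Ker_d \<inter> Ker_dc"
  by (auto simp: Ker_dc_def Ker_d_def d_d dc_d d_linear)

lemma Im_sum_sub: "Im_d_plus_Im_dc \<subseteq> d -` Im_dc"
proof -
  have "d (d x + dc y) = dc (d (- y))" for x y by (simp add: d_linear dc_linear d_d dc_d)
  then show ?thesis by (auto simp: Im_d_plus_Im_dc_def Im_d_def Im_dc_def)
qed

lemma d_vimage_sub: "d -` Im_dc \<subseteq> Ker_ddc"
proof
  fix x assume "x \<in> d -` Im_dc"
  then obtain y where "d x = dc y" by (auto simp: Im_dc_def)
  then have "d (dc x) = - dc (dc y)" using dc_d[of x] by simp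
  then show "x \<in> Ker_ddc" by (simp add: Ker_ddc_def dc_dc)
qed

lemma subspace_pair_degree:
  assumes "subspace V" "subspace W" "W \<subseteq> V"
  shows "subspace_pair scale (V \<inter> total k) (W \<inter> total k)"
proof (intro subspace_pair.intro subspace_pair_axioms.intro)
  show "vector_space scale" by (rule vector_space_axioms)
qed (use assms subspace_total subspace_inter in auto)

lemma zero_module_degree_quotient:
  assumes "subspace V" "subspace W" "W \<subseteq> V"
  shows "zero_module (degree_quotient V W k) \<longleftrightarrow> V \<inter> total k \<subseteq> W"
  using subspace_pair.zero_module_Q[OF subspace_pair_degree[OF assms, of k]]
  unfolding degree_quotient_def subspace_pair.Q_def[OF subspace_pair_degree[OF assms, of k]] by auto

lemma zero_H_urcorner_iff: "zero_module (H_urcorner k) \<longleftrightarrow> d ` Ker_dc \<inter> total k \<subseteq> Im_ddc"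
  unfolding H_urcorner_def
  by (intro zero_module_degree_quotient subspace_d_image subspace_Ker_dc subspace_Im_ddc Im_ddc_sub)

lemma zero_H_llcorner_iff: "zero_module (H_llcorner k) \<longleftrightarrow> Ker_ddc \<inter> total k \<subseteq> d -` Im_dc"
  unfolding H_llcorner_def
  by (intro zero_module_degree_quotient subspace_d_vimage subspace_Ker_ddc subspace_Im_dc d_vimage_sub)

text \<open>In degree \<open>k\<close> source and target are quotients of the same space by
  \<open>Im_ddc \<subseteq> d ` Ker_dc\<close>, so \<open>\<phi>\<close> is onto and its kernel is the first obstruction group.\<close>

lemma phi_iso_iff: "linear_iso (H_BC k) (H_Ker_dc k) (phi k) \<longleftrightarrow> zero_module (H_urcorner k)"
proof -
  have sub: "subspace (Ker_d \<inter> Ker_dc)" by (intro subspace_inter subspace_Ker_d subspace_Ker_dc)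
  have "subspace_pair scale ((Ker_d \<inter> Ker_dc) \<inter> total k) (Im_ddc \<inter> total k)"
    using sub Im_ddc_sub d_Ker_dc_sub by (intro subspace_pair_degree subspace_Im_ddc) auto
  moreover have "subspace_pair scale ((Ker_d \<inter> Ker_dc) \<inter> total k) (d ` Ker_dc \<inter> total k)"
    using sub d_Ker_dc_sub by (intro subspace_pair_degree subspace_d_image subspace_Ker_dc) auto
  ultimately have "linear_iso (H_BC k) (H_Ker_dc k) (phi k) \<longleftrightarrow>
      ((Ker_d \<inter> Ker_dc) \<inter> total k) \<inter> (d ` Ker_dc \<inter> total k) \<subseteq> Im_ddc \<inter> total k \<and>
      (\<forall>x\<in>(Ker_d \<inter> Ker_dc) \<inter> total k. \<exists>y\<in>(Ker_d \<inter> Ker_dc) \<inter> total k. x - y \<in> d ` Ker_dc \<inter> total k)"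
    unfolding H_BC_def H_Ker_dc_def phi_def degree_quotient_def
    by (rule linear_iso_induced_by_id) (use Im_ddc_sub in auto)
  also have "\<dots> \<longleftrightarrow> d ` Ker_dc \<inter> total k \<subseteq> Im_ddc"
  proof -
    have "0 \<in> d ` Ker_dc \<inter> total k"
      using subspace_0[OF subspace_d_image[OF subspace_Ker_dc]] subspace_0[OF subspace_total] by auto
    then have "\<forall>x\<in>(Ker_d \<inter> Ker_dc) \<inter> total k. \<exists>y\<in>(Ker_d \<inter> Ker_dc) \<inter> total k. x - y \<in> d ` Ker_dc \<inter> total k"
      by (metis diff_self)
    then show ?thesis using d_Ker_dc_sub by blast
  qed
  finally show ?thesis by (simp add: zero_H_urcorner_iff)
qed

text \<open>Here source and target are quotients of \<open>d -` Im_dc \<subseteq> Ker_ddc\<close> by the same space, so \<open>\<psi>\<close> is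
  injective and its cokernel is the second obstruction group.\<close>

lemma psi_iso_iff: "linear_iso (H_mod_Im_dc k) (H_A k) (psi k) \<longleftrightarrow> zero_module (H_llcorner k)"
proof -
  have "subspace_pair scale (d -` Im_dc \<inter> total k) (Im_d_plus_Im_dc \<inter> total k)"
    using Im_sum_sub by (intro subspace_pair_degree subspace_d_vimage subspace_Im_dc subspace_Im_d_plus_Im_dc)
  moreover have "subspace_pair scale (Ker_ddc \<inter> total k) (Im_d_plus_Im_dc \<inter> total k)"
    using Im_sum_sub d_vimage_sub
    by (intro subspace_pair_degree subspace_Ker_ddc subspace_Im_d_plus_Im_dc) auto
  ultimately have "linear_iso (H_mod_Im_dc k) (H_A k) (psi k) \<longleftrightarrow>
      (d -` Im_dc \<inter> total k) \<inter> (Im_d_plus_Im_dc \<inter> total k) \<subseteq> Im_d_plus_Im_dc \<inter> total k \<and>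
      (\<forall>x\<in>Ker_ddc \<inter> total k. \<exists>y\<in>d -` Im_dc \<inter> total k. x - y \<in> Im_d_plus_Im_dc \<inter> total k)"
    unfolding H_mod_Im_dc_def H_A_def psi_def degree_quotient_def
    by (rule linear_iso_induced_by_id) (use d_vimage_sub in auto)
  also have "\<dots> \<longleftrightarrow> Ker_ddc \<inter> total k \<subseteq> d -` Im_dc"
  proof
    assume *: "(d -` Im_dc \<inter> total k) \<inter> (Im_d_plus_Im_dc \<inter> total k) \<subseteq> Im_d_plus_Im_dc \<inter> total k \<and>
      (\<forall>x\<in>Ker_ddc \<inter> total k. \<exists>y\<in>d -` Im_dc \<inter> total k. x - y \<in> Im_d_plus_Im_dc \<inter> total k)"
    show "Ker_ddc \<inter> total k \<subseteq> d -` Im_dc"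
    proof
      fix x assume "x \<in> Ker_ddc \<inter> total k"
      then obtain y where "y \<in> d -` Im_dc" "x - y \<in> Im_d_plus_Im_dc" using * by blast
      then show "x \<in> d -` Im_dc"
        using subspace_add[OF subspace_d_vimage[OF subspace_Im_dc], of y "x - y"] Im_sum_sub by auto
    qed
  next
    assume sub: "Ker_ddc \<inter> total k \<subseteq> d -` Im_dc"
    have "0 \<in> Im_d_plus_Im_dc \<inter> total k"
      using subspace_0[OF subspace_Im_d_plus_Im_dc] subspace_0[OF subspace_total] by auto
    then have "\<exists>y\<in>d -` Im_dc \<inter> total k. x - y \<in> Im_d_plus_Im_dc \<inter> total k"
      if "x \<in> Ker_ddc \<inter> total k" for x
      using that sub by (intro bexI[of _ x]) auto
    then show "(d -` Im_dc \<inter> total k) \<inter> (Im_d_plus_Im_dc \<inter> total k) \<subseteq> Im_d_plus_Im_dc \<inter> total k \<and>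
      (\<forall>x\<in>Ker_ddc \<inter> total k. \<exists>y\<in>d -` Im_dc \<inter> total k. x - y \<in> Im_d_plus_Im_dc \<inter> total k)"
      by blast
  qed
  finally show ?thesis by (simp add: zero_H_llcorner_iff)
qed

section \<open>The obstruction groups in terms of del and delb\<close>

text \<open>The sign \<open>(-1)\<^sup>p\<close> on bidegree \<open>(p, q)\<close>. It anticommutes with \<open>del\<close> and commutes with \<open>delb\<close>, so it
  exchanges \<open>d\<close> and \<open>dc\<close> up to a nonzero scalar, while preserving bidegrees.\<close>

definition twist :: "'a \<Rightarrow> 'a" where
  "twist x = truncate {(p, q). even p} x - truncate {(p, q). odd p} x"

lemma component_twist: "component p q (twist x) = (if even p then component p q x else - component p q x)"
  by (simp add: twist_def component_linear component_truncate)

lemma twist_linear: "twist (x + y) = twist x + twist y" "twist (scale c x) = scale c (twist x)"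
  "twist (- x) = - twist x" "twist 0 = 0"
  by (rule component_eqI, simp add: component_twist component_linear)+

lemma twist_twist: "twist (twist x) = x"
  by (rule component_eqI) (simp add: component_twist)

lemma twist_del: "twist (del x) = - del (twist x)"
  by (rule component_eqI) (simp add: component_twist component_linear component_del del_linear)

lemma twist_delb: "twist (delb x) = delb (twist x)"
  by (rule component_eqI) (simp add: component_twist component_linear component_delb delb_linear)

lemma twist_in_total: "x \<in> total k \<Longrightarrow> twist x \<in> total k"
  by (simp add: mem_total_iff component_twist)

lemma twist_homogeneous: "x \<in> A p q \<Longrightarrow> twist x = (if even p then x else - x)"
  by (rule component_eqI) (simp add: component_twist component_linear component_homogeneous)

lemma dc_twist: "dc (twist x) = scale \<i> (twist (d x))"
  by (simp add: dc_def d_def twist_linear twist_del twist_delb)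

lemma twist_in_Im_dc_iff: "twist x \<in> Im_dc \<longleftrightarrow> x \<in> Im_d"
proof
  assume "x \<in> Im_d"
  then obtain y where "x = d y" by (auto simp: Im_d_def)
  then have "twist x = dc (scale (- \<i>) (twist y))" by (simp add: dc_linear dc_twist)
  then show "twist x \<in> Im_dc" by (auto simp: Im_dc_def)
next
  assume "twist x \<in> Im_dc"
  then obtain y where "twist x = dc y" by (auto simp: Im_dc_def)
  then have "twist x = scale \<i> (twist (d (twist y)))" using dc_twist[of "twist y"] by (simp add: twist_twist)
  then have "twist (twist x) = twist (twist (d (scale \<i> (twist y))))" by (simp add: twist_linear d_linear)
  then have "x = d (scale \<i> (twist y))" by (simp add: twist_twist)
  then show "x \<in> Im_d" by (auto simp: Im_d_def)
qed

lemma twist_in_Ker_dc_iff: "twist x \<in> Ker_dc \<longleftrightarrow> d x = 0"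
proof -
  have "d x = 0" if "twist (d x) = 0" using that twist_twist[of "d x"] by (simp add: twist_linear)
  then show ?thesis by (auto simp: Ker_dc_def dc_twist twist_linear)
qed

lemma mem_Im_ddc_iff: "x \<in> Im_ddc \<longleftrightarrow> (\<exists>u. x = del (delb u))"
proof
  assume "x \<in> Im_ddc"
  then obtain u where "x = del (delb (scale (2 * \<i>) u))" by (auto simp: Im_ddc_def d_dc del_linear delb_linear)
  then show "\<exists>u. x = del (delb u)" by blast
next
  assume "\<exists>u. x = del (delb u)"
  then obtain u where "x = del (delb u)" by blast
  then have "x = d (dc (scale (1 / (2 * \<i>)) u))" by (simp add: d_dc del_linear delb_linear)
  then show "x \<in> Im_ddc" unfolding Im_ddc_def by blast
qed

lemma mem_Ker_ddc_iff: "x \<in> Ker_ddc \<longleftrightarrow> del (delb x) = 0"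
  by (simp add: Ker_ddc_def d_dc)

text \<open>For \<open>d\<close>-closed \<open>x\<close> of degree \<open>k\<close> with \<open>del x = del (delb u)\<close>, the element \<open>x - d u\<close> is killed by both
  \<open>del\<close> and \<open>delb\<close>, hence so is each of its components. Thus \<open>types_span k\<close> expresses that the classes
  of closed elements of pure bidegree span the cohomology in degree \<open>k\<close>; see
  \<open>span_hodge_reps_weight_iff\<close>.\<close>

definition types_span :: "int \<Rightarrow> bool" where
  "types_span k \<longleftrightarrow> (\<forall>x\<in>total k. d x = 0 \<longrightarrow> (\<exists>u. del x = del (delb u)))"

text \<open>If \<open>del (delb u) = 0\<close> with \<open>u\<close> of bidegree \<open>(r, k - 1 - r)\<close>, then \<open>del u\<close> and \<open>delb u\<close> are closed elements
  of neighbouring bidegrees in degree \<open>k\<close> whose sum is exact. \<open>types_independent k\<close> says that such a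
  relation between classes of pure bidegree is always trivial.\<close>

definition types_independent :: "int \<Rightarrow> bool" where
  "types_independent k \<longleftrightarrow> (\<forall>r u. u \<in> A r (k - 1 - r) \<and> del (delb u) = 0 \<longrightarrow> del u \<in> Im_d)"

lemma twist_in_Im_ddc: "x \<in> Im_ddc \<Longrightarrow> twist x \<in> Im_ddc"
proof -
  assume "x \<in> Im_ddc"
  then obtain u where "x = del (delb u)" by (auto simp: mem_Im_ddc_iff)
  then have "twist x = del (delb (- twist u))" by (simp add: twist_del twist_delb del_linear delb_linear)
  then show "twist x \<in> Im_ddc" by (auto simp: mem_Im_ddc_iff)
qed

lemma d_twist_closed:
  assumes "d x = 0"
  shows "d (twist x) = scale (- 2) (twist (del x))"
proof -
  have "delb x = - del x" using assms by (simp add: d_def eq_neg_iff_add_eq_0 add.commute)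
  then have "delb (twist x) = - twist (del x)" by (metis twist_delb twist_linear(3))
  moreover have "del (twist x) = - twist (del x)" by (simp add: twist_del)
  ultimately have "d (twist x) = - (twist (del x) + twist (del x))"
    unfolding d_def by (simp only: minus_add_distrib)
  also have "twist (del x) + twist (del x) = scale 2 (twist (del x))"
    using scale_left_distrib[of 1 1 "twist (del x)"] by simp
  finally show ?thesis by simp
qed

text \<open>After the sign change, an element of \<open>Ker_dc\<close> becomes a \<open>d\<close>-closed element \<open>x\<close>, and the differential of
  the original element becomes a nonzero multiple of \<open>twist (del x)\<close>. So \<open>d ` Ker_dc \<subseteq> Im_ddc\<close> in degree \<open>k + 1\<close> says
  exactly that \<open>del x\<close> lies in the image of \<open>del delb\<close> for closed \<open>x\<close> of degree \<open>k\<close>.\<close>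

lemma zero_H_urcorner_iff_types_span: "zero_module (H_urcorner (k + 1)) \<longleftrightarrow> types_span k"
  unfolding zero_H_urcorner_iff
proof
  assume L: "d ` Ker_dc \<inter> total (k + 1) \<subseteq> Im_ddc"
  show "types_span k"
    unfolding types_span_def
  proof (intro ballI impI)
    fix x assume x: "x \<in> total k" "d x = 0"
    have "d (twist x) \<in> d ` Ker_dc \<inter> total (k + 1)"
      using x twist_in_Ker_dc_iff twist_in_total d_in_total by blast
    then have "scale (- 2) (twist (del x)) \<in> Im_ddc" using L d_twist_closed[OF x(2)] by auto
    then have "scale (- 1 / 2) (scale (- 2) (twist (del x))) \<in> Im_ddc"
      by (rule subspace_scale[OF subspace_Im_ddc])
    then have "twist (del x) \<in> Im_ddc" by simp
    then have "twist (twist (del x)) \<in> Im_ddc" by (rule twist_in_Im_ddc)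
    then show "\<exists>u. del x = del (delb u)" by (simp add: twist_twist mem_Im_ddc_iff)
  qed
next
  assume R: "types_span k"
  show "d ` Ker_dc \<inter> total (k + 1) \<subseteq> Im_ddc"
  proof
    fix y assume y: "y \<in> d ` Ker_dc \<inter> total (k + 1)"
    then obtain x where x: "dc x = 0" "y = d x" by (auto simp: Ker_dc_def)
    \<comment> \<open>Only the degree \<open>k\<close> part of \<open>x\<close> contributes to \<open>y\<close>, and it stays in \<open>Ker_dc\<close>.\<close>
    define T where "T j = truncate {(p, q). p + q = j}" for j :: int
    have T: "T (k + 1) (del z) = del (T k z)" "T (k + 1) (delb z) = delb (T k z)" for z
      by (simp_all add: T_def truncate_Suc_del truncate_Suc_delb)
    define z where "z = twist (T k x)"
    have "scale \<i> (delb x - del x) = 0" using x(1) by (simp add: dc_def)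
    then have "delb x = del x" by simp
    then have "delb (T k x) = del (T k x)" using T by metis
    then have "dc (T k x) = 0" by (simp add: dc_def)
    then have z: "d z = 0" using twist_in_Ker_dc_iff[of z] by (simp add: z_def twist_twist Ker_dc_def)
    have "z \<in> total k" using twist_in_total truncate_in_total by (simp add: z_def T_def)
    then have "del z \<in> Im_ddc" using R z by (simp add: types_span_def mem_Im_ddc_iff)
    then have "scale (- 2) (twist (del z)) \<in> Im_ddc"
      by (intro subspace_scale[OF subspace_Im_ddc] twist_in_Im_ddc)
    moreover have "d (twist z) = y"
    proof -
      have "y = T (k + 1) (d x)" using y x(2) truncate_id by (simp add: T_def)
      also have "\<dots> = T (k + 1) (del x) + T (k + 1) (delb x)" by (simp add: T_def d_def truncate_add)
      also have "\<dots> = d (T k x)" by (simp add: T d_def)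
      finally show ?thesis by (simp add: z_def twist_twist)
    qed
    ultimately show "y \<in> Im_ddc" using d_twist_closed[OF z] by simp
  qed
qed

lemma types_independent_exact:
  assumes "types_independent k" "u \<in> A r (k - 1 - r)" "del (delb u) = 0"
  shows "del u \<in> Im_d" "delb u \<in> Im_d"
proof -
  show "del u \<in> Im_d" using assms by (auto simp: types_independent_def)
  moreover have "delb u = d u - del u" by (simp add: d_def)
  ultimately show "delb u \<in> Im_d" using subspace_diff[OF subspace_Im_d] by (auto simp: Im_d_def)
qed

text \<open>Let \<open>u\<close> be homogeneous with \<open>del (delb u) = 0\<close>. By the sign change \<open>d u \<in> Im_dc\<close> means that
  \<open>delb u - del u\<close> is \<open>d\<close>-exact; since \<open>delb u + del u\<close> is exact anyway, this is exactness of \<open>del u\<close>.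
  Conversely a homogeneous element in the image of \<open>d\<close> is in the image of \<open>dc\<close>, because \<open>twist\<close> maps
  it to itself or its negative.\<close>

lemma zero_H_llcorner_iff_types_independent: "zero_module (H_llcorner (k - 1)) \<longleftrightarrow> types_independent k"
  unfolding zero_H_llcorner_iff
proof
  assume L: "Ker_ddc \<inter> total (k - 1) \<subseteq> d -` Im_dc"
  show "types_independent k"
    unfolding types_independent_def
  proof (intro allI impI)
    fix r u assume "u \<in> A r (k - 1 - r) \<and> del (delb u) = 0"
    then have u: "u \<in> A r (k - 1 - r)" "del (delb u) = 0" by auto
    have "u \<in> total (k - 1)" by (rule A_sub_total[OF u(1)]) simp
    then have "twist (twist (d u)) \<in> Im_dc" using L u(2) by (auto simp: mem_Ker_ddc_iff twist_twist)
    then have tw: "twist (d u) \<in> Im_d" unfolding twist_in_Im_dc_iff .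
    have eq: "twist (d u) = (if even r then delb u - del u else del u - delb u)"
      using twist_homogeneous[OF u(1)]
      by (auto simp: d_def twist_linear twist_del twist_delb del_linear delb_linear)
    have "delb u - del u \<in> Im_d"
      using tw subspace_neg[OF subspace_Im_d tw] unfolding eq by (auto split: if_splits)
    moreover have "d u \<in> Im_d" by (simp add: Im_d_def)
    ultimately have "scale (1 / 2) (d u - (delb u - del u)) \<in> Im_d"
      by (intro subspace_scale[OF subspace_Im_d] subspace_diff[OF subspace_Im_d, of "d u"])
    moreover have "scale (1 / 2) (d u - (delb u - del u)) = del u"
      by (simp add: d_def scale_right_distrib flip: scale_left_distrib)
    ultimately show "del u \<in> Im_d" by simp
  qed
next
  assume R: "types_independent k"
  show "Ker_ddc \<inter> total (k - 1) \<subseteq> d -` Im_dc"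
  proof
    fix u assume "u \<in> Ker_ddc \<inter> total (k - 1)"
    then have u: "del (delb u) = 0" "u \<in> total (k - 1)" by (auto simp: mem_Ker_ddc_iff)
    have "d (component p q u) \<in> Im_dc" if nz: "component p q u \<noteq> 0" for p q
    proof -
      have "p + q = k - 1" using u(2) nz by (auto simp: mem_total_iff)
      then have q: "q = k - 1 - p" by simp
      have c: "component p q u \<in> A p (k - 1 - p)" using component_in q by simp
      have "del (delb (component p q u)) = component (p + 1) (q + 1) (del (delb u))"
        by (simp add: component_del component_delb)
      then have "del (delb (component p q u)) = 0" using u(1) by (simp add: component_zero)
      note i = types_independent_exact[OF R c this]
      have "x \<in> Im_dc" if "x \<in> Im_d" "x \<in> A r s" for x r s
      proof -
        have "twist x \<in> Im_dc" using that twist_in_Im_dc_iff by simp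
        then show ?thesis
          using twist_homogeneous[OF that(2)] subspace_neg[OF subspace_Im_dc, of "- x"] by (auto split: if_splits)
      qed
      then show ?thesis
        unfolding d_def using i del_in[OF c] delb_in[OF c] by (intro subspace_add subspace_Im_dc)
    qed
    then have "(\<Sum>(p, q)\<in>{(p, q). component p q u \<noteq> 0}. d (component p q u)) \<in> Im_dc"
      by (intro subspace_sum[OF subspace_Im_dc]) auto
    moreover have "d u = (\<Sum>(p, q)\<in>{(p, q). component p q u \<noteq> 0}. d (component p q u))"
      by (subst sum_component_support[of u]) (simp add: d_linear case_prod_unfold)
    ultimately show "u \<in> d -` Im_dc" by simp
  qed
qed


section \<open>Hodge filtrations in terms of representatives\<close>

lemma subspace_pair_H_dR: "subspace_pair scale (Ker_d \<inter> total k) (Im_d \<inter> total k)"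
  by (intro subspace_pair_degree subspace_Ker_d subspace_Im_d) (auto simp: Im_d_def Ker_d_def d_d)

lemma H_dR_eq_Q: "H_dR k = subspace_pair.Q scale (Ker_d \<inter> total k) (Im_d \<inter> total k)"
  by (simp add: H_dR_def degree_quotient_def subspace_pair.Q_def[OF subspace_pair_H_dR])

abbreviation dR_class :: "int \<Rightarrow> 'a \<Rightarrow> 'a set" where
  "dR_class k x \<equiv> (Im_d \<inter> total k) +>\<^bsub>whole_module scale\<^esub> x"

lemmas carrier_H_dR = subspace_pair.carrier_Q[OF subspace_pair_H_dR, folded H_dR_eq_Q]
lemmas dR_class_eq_iff = subspace_pair.coset_eq_iff[OF subspace_pair_H_dR]
lemmas mem_dR_class_iff = subspace_pair.mem_coset_iff[OF subspace_pair_H_dR]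
lemmas dR_class_zero = subspace_pair.coset_zero[OF subspace_pair_H_dR]
lemmas dR_class_eq_zero_iff = subspace_pair.coset_eq_W_iff[OF subspace_pair_H_dR]

text \<open>The closed elements of degree \<open>k\<close> whose classes lie in \<open>F p k \<inter> F_conj q k\<close>.\<close>

definition hodge_reps :: "int \<Rightarrow> int \<Rightarrow> int \<Rightarrow> 'a set" where
  "hodge_reps k p q = {x \<in> Ker_d \<inter> total k.
     (\<exists>y\<in>Fil p k. d y = 0 \<and> x - y \<in> Im_d) \<and> (\<exists>z\<in>Fil_conj q k. d z = 0 \<and> x - z \<in> Im_d)}"

lemma subspace_Fil: "subspace (Fil p k)" and subspace_Fil_conj: "subspace (Fil_conj q k)"
  by (simp_all add: Fil_def Fil_conj_def)

lemma Fil_sub_total: "x \<in> Fil p k \<Longrightarrow> x \<in> total k" and Fil_conj_sub_total: "x \<in> Fil_conj q k \<Longrightarrow> x \<in> total k"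
  by (simp_all add: mem_Fil_iff mem_Fil_conj_iff)

lemma F_inter_F_conj: "F p k \<inter> F_conj q k = dR_class k ` hodge_reps k p q"
proof -
  have "dR_class k x \<in> F p k \<longleftrightarrow> (\<exists>y\<in>Fil p k. d y = 0 \<and> x - y \<in> Im_d)"
    and "dR_class k x \<in> F_conj q k \<longleftrightarrow> (\<exists>y\<in>Fil_conj q k. d y = 0 \<and> x - y \<in> Im_d)"
    if x: "x \<in> Ker_d \<inter> total k" for x
  proof -
    have sw: "y - x \<in> Im_d \<longleftrightarrow> x - y \<in> Im_d" for y
      using subspace_neg[OF subspace_Im_d, of "x - y"] subspace_neg[OF subspace_Im_d, of "y - x"] by auto
    have tot: "y - x \<in> total k" if "y \<in> total k" for y
      using x that subspace_diff[OF subspace_total] by blast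
    show "dR_class k x \<in> F p k \<longleftrightarrow> (\<exists>y\<in>Fil p k. d y = 0 \<and> x - y \<in> Im_d)"
      using x tot Fil_sub_total sw by (auto simp: F_def carrier_H_dR mem_dR_class_iff)
    show "dR_class k x \<in> F_conj q k \<longleftrightarrow> (\<exists>y\<in>Fil_conj q k. d y = 0 \<and> x - y \<in> Im_d)"
      using x tot Fil_conj_sub_total sw by (auto simp: F_conj_def carrier_H_dR mem_dR_class_iff)
  qed
  note this[simp]
  have "F p k \<inter> F_conj q k \<subseteq> dR_class k ` (Ker_d \<inter> total k)"
    by (auto simp: F_def carrier_H_dR)
  then show ?thesis by (fastforce simp: hodge_reps_def)
qed

lemma hodge_reps_sub: "hodge_reps k p q \<subseteq> Ker_d \<inter> total k"
  by (auto simp: hodge_reps_def)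

lemma subspace_hodge_reps: "subspace (hodge_reps k p q)"
proof -
  have *: "subspace {x. \<exists>y\<in>U. d y = 0 \<and> x - y \<in> Im_d}" if "subspace U" for U
  proof -
    have "{x. \<exists>y\<in>U. d y = 0 \<and> x - y \<in> Im_d} = {y + w | y w. y \<in> U \<inter> Ker_d \<and> w \<in> Im_d}"
      by (force simp: Ker_d_def intro: exI[of _ "_ - _"])
    then show ?thesis
      using subspace_sums[OF subspace_inter[OF that subspace_Ker_d] subspace_Im_d] by simp
  qed
  have "hodge_reps k p q = (Ker_d \<inter> total k) \<inter> {x. \<exists>y\<in>Fil p k. d y = 0 \<and> x - y \<in> Im_d} \<inter>
      {x. \<exists>y\<in>Fil_conj q k. d y = 0 \<and> x - y \<in> Im_d}"
    by (auto simp: hodge_reps_def)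
  then show ?thesis
    by (simp only:) (intro subspace_inter subspace_Ker_d subspace_total * subspace_Fil subspace_Fil_conj)
qed

lemma exact_sub_hodge_reps: "Im_d \<inter> total k \<subseteq> hodge_reps k p q"
  using subspace_0[OF subspace_Fil, of p k] subspace_0[OF subspace_Fil_conj, of q k]
  by (auto simp: hodge_reps_def Ker_d_def Im_d_def d_d d_linear intro!: bexI[of _ 0])

text \<open>All further statements about \<open>F_tot\<close> are read off from this description by representatives.\<close>

lemma F_tot_eq: "F_tot r k = dR_class k ` span (\<Union>p. hodge_reps k p (r - p))"
  unfolding F_tot_def F_inter_F_conj H_dR_eq_Q
  by (rule subspace_pair.sum_of_subspaces_Q[OF subspace_pair_H_dR])
    (use subspace_hodge_reps hodge_reps_sub in auto)

lemma span_hodge_reps_sub: "span (\<Union>p. hodge_reps k p (r - p)) \<subseteq> Ker_d \<inter> total k"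
  using hodge_reps_sub by (intro span_minimal subspace_inter subspace_Ker_d subspace_total) blast

text \<open>A class in \<open>F p k \<inter> F_conj q k\<close> has representatives \<open>y\<close> in \<open>Fil p k\<close> and \<open>z\<close> in \<open>Fil_conj q k\<close>, with
  \<open>y - z = d u\<close>. Subtracting from \<open>y\<close> the differential of the part of \<open>u\<close> in bidegrees \<open>(r, s)\<close> with
  \<open>r \<ge> p\<close> gives a representative \<open>w\<close> that still has no component with \<open>r < p\<close>. It is also \<open>z\<close> plus the
  differential of the remaining part of \<open>u\<close>, which reaches bidegrees with \<open>r = p\<close> only through \<open>del\<close>.
  So above \<open>p\<close> the components of \<open>w\<close> are those of \<open>z\<close>.\<close>

lemma hodge_reps_truncate:
  assumes "x \<in> hodge_reps k p q"
  obtains w z u where "w \<in> total k" "d w = 0" "x - w \<in> Im_d" "z \<in> Fil_conj q k"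
    "\<And>r s. component r s w =
      (if r < p then 0 else component r s z + (if r = p then del (component (r - 1) s u) else 0))"
proof -
  obtain y z where y: "y \<in> Fil p k" "d y = 0" "x - y \<in> Im_d" and z: "z \<in> Fil_conj q k" "d z = 0" "x - z \<in> Im_d"
    using assms by (auto simp: hodge_reps_def)
  have "y - z = (x - z) - (x - y)" by simp
  then have "y - z \<in> Im_d" using y z subspace_diff[OF subspace_Im_d] by metis
  moreover have "y - z \<in> total k" using y z Fil_sub_total Fil_conj_sub_total subspace_diff[OF subspace_total] by blast
  ultimately obtain u where u: "u \<in> total (k - 1)" "y - z = d u" by (rule Im_d_total)
  define t where "t = truncate {(r, s). p \<le> r} u"
  define w where "w = y - d t"
  have "t \<in> total (k - 1)"
    using u(1) by (auto simp: mem_total_iff component_truncate t_def)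
  from d_in_total[OF this] have 1: "w \<in> total k"
    unfolding w_def using Fil_sub_total[OF y(1)] subspace_diff[OF subspace_total] by simp
  have 2: "d w = 0" by (simp add: w_def d_linear d_d y(2))
  have xw: "x - w = (x - y) + d t" unfolding w_def by (simp add: algebra_simps)
  have 3: "x - w \<in> Im_d"
    unfolding xw by (rule subspace_add[OF subspace_Im_d y(3)]) (simp add: Im_d_def)
  have "y = z + d u" using u(2) by (simp add: algebra_simps)
  then have "component r s y = component r s z + (del (component (r - 1) s u) + delb (component r (s - 1) u))" for r s
    by (simp add: component_linear component_d)
  moreover have "r < p \<Longrightarrow> component r s y = 0" for r s using y(1) by (simp add: mem_Fil_iff)
  ultimately have 4: "component r s w =
      (if r < p then 0 else component r s z + (if r = p then del (component (r - 1) s u) else 0))" for r s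
    by (auto simp: w_def t_def component_linear component_d component_truncate del_linear delb_linear)
  show ?thesis by (rule that[OF 1 2 3 z(1) 4])
qed

lemma closed_homogeneous:
  assumes "x \<in> A p q" "d x = 0"
  shows "del x = 0" "delb x = 0"
proof -
  have c: "component r s (del x) + component r s (delb x) = 0" for r s
    using assms(2) by (simp add: d_def component_zero flip: component_add)
  note h = component_homogeneous[OF del_in[OF assms(1)]] component_homogeneous[OF delb_in[OF assms(1)]]
  show "del x = 0" using c[of "p + 1" q] by (simp add: h)
  show "delb x = 0" using c[of p "q + 1"] by (simp add: h)
qed

lemma mem_A_if_component_zero:
  assumes "\<And>r s. (r, s) \<noteq> (p, q) \<Longrightarrow> component r s x = 0"
  shows "x \<in> A p q"
proof -
  have "component r s x = component r s (component p q x)" for r s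
    using assms[of r s] by (auto simp: component_component)
  then have "x = component p q x" by (rule component_eqI)
  then show ?thesis using component_in[of p q x] by simp
qed

lemma hodge_reps_intro:
  assumes "x \<in> A p q" "p + q = k" "d x = 0" "p' \<le> p" "q' \<le> q"
  shows "x \<in> hodge_reps k p' q'"
proof -
  have t: "x \<in> total k" using A_sub_total assms by blast
  have "x \<in> Fil p' k" "x \<in> Fil_conj q' k"
    using t assms by (auto simp: mem_Fil_iff mem_Fil_conj_iff component_homogeneous)
  moreover have "x - x \<in> Im_d" using subspace_0[OF subspace_Im_d] by simp
  ultimately show ?thesis using t assms(3) unfolding hodge_reps_def Ker_d_def by blast
qed

text \<open>In complementary indices \<open>p + q = k\<close> both conditions on the truncated representative leave only the
  bidegree \<open>(p, k - p)\<close>.\<close>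

lemma hodge_reps_weight:
  assumes "x \<in> hodge_reps k p (k - p)"
  obtains z where "z \<in> A p (k - p)" "d z = 0" "x - z \<in> Im_d"
proof -
  obtain w z u where w: "w \<in> total k" "d w = 0" "x - w \<in> Im_d" and z: "z \<in> Fil_conj (k - p) k"
    and c: "\<And>r s. component r s w =
      (if r < p then 0 else component r s z + (if r = p then del (component (r - 1) s u) else 0))"
    using hodge_reps_truncate[OF assms] by metis
  have "w \<in> A p (k - p)"
  proof (rule mem_A_if_component_zero)
    fix r s assume rs: "(r, s) \<noteq> (p, k - p)"
    show "component r s w = 0"
    proof (cases "r + s = k")
      case True
      then have "r < p \<or> (p < r \<and> s < k - p)" using rs by auto
      then show ?thesis using z c[of r s] by (auto simp: mem_Fil_conj_iff)
    next
      case False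
      then show ?thesis using w(1) by (simp add: mem_total_iff)
    qed
  qed
  then show ?thesis using w(2,3) by (rule that)
qed

text \<open>In indices with \<open>p + q = k + 1\<close> the element \<open>z\<close> contributes nothing in bidegrees with \<open>r \<ge> p\<close>, and only
  \<open>del\<close> of the component of \<open>u\<close> in bidegree \<open>(p - 1, k - p)\<close> survives.\<close>

lemma hodge_reps_weight_Suc:
  assumes "x \<in> hodge_reps k p (k + 1 - p)"
  obtains v where "v \<in> A (p - 1) (k - p)" "del (delb v) = 0" "x - del v \<in> Im_d"
proof -
  obtain w z u where w: "w \<in> total k" "d w = 0" "x - w \<in> Im_d" and z: "z \<in> Fil_conj (k + 1 - p) k"
    and c: "\<And>r s. component r s w =
      (if r < p then 0 else component r s z + (if r = p then del (component (r - 1) s u) else 0))"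
    using hodge_reps_truncate[OF assms] by metis
  define v where "v = component (p - 1) (k - p) u"
  have v: "v \<in> A (p - 1) (k - p)" by (simp add: v_def component_in)
  have wv: "w = del v"
  proof (rule component_eqI)
    fix r s
    show "component r s w = component r s (del v)"
    proof (cases "r + s = k")
      case True
      then have "r < p \<or> (r = p \<and> s = k - p \<and> s < k + 1 - p) \<or> (p < r \<and> s < k + 1 - p)" by auto
      then show ?thesis using z c[of r s]
        by (auto simp: mem_Fil_conj_iff component_del v_def component_component del_linear)
    next
      case False
      then show ?thesis using w(1)
        by (auto simp: mem_total_iff component_del v_def component_component del_linear)
    qed
  qed
  have "delb (del v) = 0" using w(2) by (simp add: wv d_def del_del)
  then have "del (delb v) = 0" by (simp add: delb_del)
  then show ?thesis using that v w(3) wv by simp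
qed

text \<open>A closed element of pure bidegree is killed by \<open>del\<close>, and adding \<open>d v\<close> changes \<open>del x\<close> by
  \<open>del (delb v)\<close>; this gives one direction. Conversely, if \<open>del x = del (delb u)\<close> then \<open>x - d u\<close> is
  killed by \<open>del\<close> and \<open>delb\<close> and splits into closed components.\<close>

lemma span_hodge_reps_weight_iff:
  "Ker_d \<inter> total k \<subseteq> span (\<Union>p. hodge_reps k p (k - p)) \<longleftrightarrow> types_span k"
proof
  assume L: "Ker_d \<inter> total k \<subseteq> span (\<Union>p. hodge_reps k p (k - p))"
  have "\<exists>u. del x = del (delb u)" if "x \<in> span (\<Union>p. hodge_reps k p (k - p))" for x
    using that
  proof (induction rule: span_induct_alt)
    case base
    show ?case by (rule exI[of _ 0]) (simp add: del_linear delb_linear)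
  next
    case (step c x y)
    then obtain p where "x \<in> hodge_reps k p (k - p)" by blast
    then obtain z where z: "z \<in> A p (k - p)" "d z = 0" "x - z \<in> Im_d" by (rule hodge_reps_weight)
    obtain v where "x - z = d v" using z(3) by (auto simp: Im_d_def)
    then have x: "x = z + (del v + delb v)" by (simp add: d_def algebra_simps)
    have "del x = del (delb v)"
      using closed_homogeneous(1)[OF z(1,2)] by (simp add: x del_linear del_del)
    moreover obtain w where "del y = del (delb w)" using step by blast
    ultimately have "del (scale c x + y) = del (delb (scale c v + w))" by (simp add: del_linear delb_linear)
    then show ?case by blast
  qed
  then show "types_span k" using L unfolding types_span_def Ker_d_def by blast
next
  assume R: "types_span k"
  show "Ker_d \<inter> total k \<subseteq> span (\<Union>p. hodge_reps k p (k - p))"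
  proof
    fix x assume "x \<in> Ker_d \<inter> total k"
    then have x: "d x = 0" "x \<in> total k" by (auto simp: Ker_d_def)
    then obtain u where u: "del x = del (delb u)" using R by (auto simp: types_span_def)
    \<comment> \<open>Replace \<open>u\<close> by its part in degree \<open>k - 1\<close>, so that \<open>x - d v\<close> stays in degree \<open>k\<close>.\<close>
    define v where "v = truncate {(p, q). p + q = k - 1} u"
    have v: "v \<in> total (k - 1)" by (simp add: v_def truncate_in_total)
    have "del x = truncate {(p, q). p + q = k + 1} (del x)"
      using x(2) by (intro truncate_id[symmetric]) (auto simp: mem_total_iff component_del del_linear)
    also have "\<dots> = del (delb v)"
      using truncate_Suc_del[of k "delb u"] truncate_Suc_delb[of "k - 1" u] by (simp add: u v_def)
    finally have delx: "del x = del (delb v)" .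
    have delbx: "delb x = - del x" using x(1) by (simp add: d_def eq_neg_iff_add_eq_0 add.commute)
    define y where "y = x - d v"
    have "del y = 0" by (simp add: y_def d_def del_linear del_del delx)
    have "delb y = 0" by (simp add: y_def d_def delb_linear delb_delb delb_del delbx delx)
    have yt: "y \<in> total k" using d_in_total[OF v] x(2) subspace_diff[OF subspace_total] by (simp add: y_def)
    have "component p q y \<in> span (\<Union>p. hodge_reps k p (k - p))" if nz: "component p q y \<noteq> 0" for p q
    proof -
      have q: "p + q = k" using nz yt by (auto simp: mem_total_iff)
      have "del (component p q y) = component (p + 1) q (del y)" "delb (component p q y) = component p (q + 1) (delb y)"
        by (simp_all add: component_del component_delb)
      then have "d (component p q y) = 0" using \<open>del y = 0\<close> \<open>delb y = 0\<close> by (simp add: d_def component_zero)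
      then have "component p q y \<in> hodge_reps k p (k - p)"
        using q by (intro hodge_reps_intro[OF component_in]) auto
      then show ?thesis by (intro span_base) blast
    qed
    then have "(\<Sum>(p, q)\<in>{(p, q). component p q y \<noteq> 0}. component p q y) \<in> span (\<Union>p. hodge_reps k p (k - p))"
      by (intro span_sum) auto
    then have "y \<in> span (\<Union>p. hodge_reps k p (k - p))" using sum_component_support[of y] by simp
    moreover have "d v \<in> span (\<Union>p. hodge_reps k p (k - p))"
    proof -
      have "d v \<in> Im_d \<inter> total k" using d_in_total[OF v] by (simp add: Im_d_def)
      then have "d v \<in> hodge_reps k 0 (k - 0)" using exact_sub_hodge_reps by blast
      then show ?thesis by (intro span_base) blast
    qed
    ultimately have "y + d v \<in> span (\<Union>p. hodge_reps k p (k - p))" by (rule span_add)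
    then show "x \<in> span (\<Union>p. hodge_reps k p (k - p))" by (simp add: y_def)
  qed
qed

lemma exact_sub_span_hodge_reps: "Im_d \<inter> total k \<subseteq> span (\<Union>p. hodge_reps k p (r - p))"
  using exact_sub_hodge_reps[of k 0 "r - 0"] span_superset[of "\<Union>p. hodge_reps k p (r - p)"] by blast

lemma F_tot_eq_carrier_iff:
  "F_tot r k = carrier (H_dR k) \<longleftrightarrow> Ker_d \<inter> total k \<subseteq> span (\<Union>p. hodge_reps k p (r - p))"
proof
  assume L: "F_tot r k = carrier (H_dR k)"
  show "Ker_d \<inter> total k \<subseteq> span (\<Union>p. hodge_reps k p (r - p))"
  proof
    fix x assume "x \<in> Ker_d \<inter> total k"
    then have "dR_class k x \<in> F_tot r k" by (simp add: L carrier_H_dR)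
    then obtain y where y: "y \<in> span (\<Union>p. hodge_reps k p (r - p))" "x - y \<in> Im_d \<inter> total k"
      by (auto simp: F_tot_eq dR_class_eq_iff)
    then have "y + (x - y) \<in> span (\<Union>p. hodge_reps k p (r - p))"
      using exact_sub_span_hodge_reps by (intro span_add) blast+
    then show "x \<in> span (\<Union>p. hodge_reps k p (r - p))" by simp
  qed
qed (use span_hodge_reps_sub[of k r] in \<open>auto simp: F_tot_eq carrier_H_dR\<close>)

lemma F_tot_eq_zero_iff:
  "F_tot r k = {Im_d \<inter> total k} \<longleftrightarrow> (\<forall>p. hodge_reps k p (r - p) \<subseteq> Im_d)"
proof
  assume L: "F_tot r k = {Im_d \<inter> total k}"
  show "\<forall>p. hodge_reps k p (r - p) \<subseteq> Im_d"
  proof (intro allI subsetI)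
    fix p x assume "x \<in> hodge_reps k p (r - p)"
    then have "dR_class k x \<in> F_tot r k" unfolding F_tot_eq by (intro imageI span_base) blast
    then show "x \<in> Im_d" using L by (simp add: dR_class_eq_zero_iff)
  qed
next
  assume R: "\<forall>p. hodge_reps k p (r - p) \<subseteq> Im_d"
  have "span (\<Union>p. hodge_reps k p (r - p)) \<subseteq> Im_d \<inter> total k"
    using R hodge_reps_sub by (intro span_minimal subspace_inter subspace_Im_d subspace_total) blast
  then have "dR_class k x = Im_d \<inter> total k" if "x \<in> span (\<Union>p. hodge_reps k p (r - p))" for x
    using that by (subst dR_class_eq_zero_iff) blast
  then show "F_tot r k = {Im_d \<inter> total k}" unfolding F_tot_eq using span_zero by blast
qed

lemma F_tot_weight_iff: "F_tot k k = carrier (H_dR k) \<longleftrightarrow> types_span k"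
  by (simp only: F_tot_eq_carrier_iff span_hodge_reps_weight_iff)

text \<open>The relation \<open>del u = d u - delb u\<close> puts the class of \<open>del u\<close> into
  \<open>F (r + 1) k \<inter> F_conj (k - r) k\<close>, and by \<open>hodge_reps_weight_Suc\<close> all classes in filtration indices of sum
  \<open>k + 1\<close> arise in this way.\<close>

lemma F_tot_weight_Suc_iff: "F_tot (k + 1) k = {Im_d \<inter> total k} \<longleftrightarrow> types_independent k"
  unfolding F_tot_eq_zero_iff
proof
  assume L: "\<forall>p. hodge_reps k p (k + 1 - p) \<subseteq> Im_d"
  show "types_independent k"
    unfolding types_independent_def
  proof (intro allI impI)
    fix r u assume "u \<in> A r (k - 1 - r) \<and> del (delb u) = 0"
    then have u: "u \<in> A r (k - 1 - r)" "del (delb u) = 0" by auto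
    have 1: "del u \<in> A (r + 1) (k - 1 - r)" by (rule del_in[OF u(1)])
    have 2: "- delb u \<in> A r (k - r)" using subspace_neg[OF subspace_A delb_in[OF u(1)]] by (simp add: algebra_simps)
    have d1: "d (del u) = 0" by (simp add: d_def del_del delb_del u)
    have d2: "d (- delb u) = 0" by (simp add: d_linear) (simp add: d_def delb_delb u)
    have t1: "del u \<in> total k" by (rule A_sub_total[OF 1]) simp
    have t2: "- delb u \<in> total k" by (rule A_sub_total[OF 2]) simp
    have "del u \<in> Fil (r + 1) k" using t1 by (auto simp: mem_Fil_iff component_homogeneous[OF 1])
    moreover have "- delb u \<in> Fil_conj (k - r) k" using t2 by (auto simp: mem_Fil_conj_iff component_homogeneous[OF 2])
    moreover have "del u - del u \<in> Im_d" "del u - (- delb u) \<in> Im_d"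
      using subspace_0[OF subspace_Im_d] by (auto simp: Im_d_def d_def)
    ultimately have "del u \<in> hodge_reps k (r + 1) (k - r)"
      using d1 d2 t1 unfolding hodge_reps_def Ker_d_def by blast
    then show "del u \<in> Im_d" using L[THEN spec, of "r + 1"] by auto
  qed
next
  assume R: "types_independent k"
  show "\<forall>p. hodge_reps k p (k + 1 - p) \<subseteq> Im_d"
  proof (intro allI subsetI)
    fix p x assume "x \<in> hodge_reps k p (k + 1 - p)"
    then obtain u where u: "u \<in> A (p - 1) (k - p)" "del (delb u) = 0" "x - del u \<in> Im_d"
      by (rule hodge_reps_weight_Suc)
    have "k - 1 - (p - 1) = k - p" by simp
    then have "del u \<in> Im_d" using R u unfolding types_independent_def by metis
    then show "x \<in> Im_d" using subspace_add[OF subspace_Im_d u(3)] by fastforce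
  qed
qed

text \<open>A relation between classes of pure bidegree has the form \<open>sum z J = d u\<close> with \<open>z p \<in> A p (k - p)\<close>
  closed. Applying \<open>del\<close> gives \<open>del (delb u) = 0\<close>, so each component of \<open>u\<close> satisfies the hypothesis of
  \<open>types_independent\<close>; and \<open>z p\<close> is \<open>del\<close> of one component of \<open>u\<close> plus \<open>delb\<close> of the next. In the other
  direction, the relation \<open>del u + delb u = d u\<close> has two terms.\<close>

lemma independent_hodge_reps_iff:
  "(\<forall>J g. finite J \<and> (\<forall>p\<in>J. g p \<in> hodge_reps k p (k - p)) \<and> sum g J \<in> Im_d \<inter> total k \<longrightarrow>
      (\<forall>p\<in>J. g p \<in> Im_d \<inter> total k)) \<longleftrightarrow> types_independent k"
proof
  assume L: "\<forall>J g. finite J \<and> (\<forall>p\<in>J. g p \<in> hodge_reps k p (k - p)) \<and> sum g J \<in> Im_d \<inter> total k \<longrightarrow>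
      (\<forall>p\<in>J. g p \<in> Im_d \<inter> total k)"
  show "types_independent k"
    unfolding types_independent_def
  proof (intro allI impI)
    fix r u assume "u \<in> A r (k - 1 - r) \<and> del (delb u) = 0"
    then have u: "u \<in> A r (k - 1 - r)" "del (delb u) = 0" by auto
    have 1: "del u \<in> A (r + 1) (k - 1 - r)" by (rule del_in[OF u(1)])
    have 2: "delb u \<in> A r (k - r)" using delb_in[OF u(1)] by (simp add: algebra_simps)
    have "d (del u) = 0" "d (delb u) = 0" by (simp_all add: d_def del_del delb_delb delb_del u)
    then have "del u \<in> hodge_reps k (r + 1) (k - (r + 1))" "delb u \<in> hodge_reps k r (k - r)"
      by (auto intro!: hodge_reps_intro[OF 1] hodge_reps_intro[OF 2])
    moreover define g where "g p = (if p = r then delb u else del u)" for p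
    moreover have "sum g {r, r + 1} \<in> Im_d \<inter> total k"
    proof -
      have "u \<in> total (k - 1)" by (rule A_sub_total[OF u(1)]) simp
      then have "d u \<in> total k" using d_in_total by fastforce
      moreover have "sum g {r, r + 1} = d u" by (simp add: g_def d_def add.commute)
      ultimately show ?thesis by (simp add: Im_d_def)
    qed
    ultimately have "\<forall>p\<in>{r, r + 1}. g p \<in> Im_d \<inter> total k"
      by (intro L[THEN spec, THEN spec, THEN mp]) auto
    then show "del u \<in> Im_d" by (simp add: g_def)
  qed
next
  assume R: "types_independent k"
  show "\<forall>J g. finite J \<and> (\<forall>p\<in>J. g p \<in> hodge_reps k p (k - p)) \<and> sum g J \<in> Im_d \<inter> total k \<longrightarrow>
      (\<forall>p\<in>J. g p \<in> Im_d \<inter> total k)"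
  proof (intro allI impI ballI)
    fix J g p
    assume A: "finite J \<and> (\<forall>p\<in>J. g p \<in> hodge_reps k p (k - p)) \<and> sum g J \<in> Im_d \<inter> total k" and p: "p \<in> J"
    have "\<forall>p\<in>J. \<exists>z. z \<in> A p (k - p) \<and> d z = 0 \<and> g p - z \<in> Im_d"
      using A hodge_reps_weight by metis
    then obtain z where z: "\<And>p. p \<in> J \<Longrightarrow> z p \<in> A p (k - p)" "\<And>p. p \<in> J \<Longrightarrow> d (z p) = 0"
      "\<And>p. p \<in> J \<Longrightarrow> g p - z p \<in> Im_d" by metis
    have "sum z J = sum g J - (\<Sum>p\<in>J. g p - z p)" by (simp add: sum_subtractf)
    moreover have "(\<Sum>p\<in>J. g p - z p) \<in> Im_d" using z by (intro subspace_sum[OF subspace_Im_d]) auto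
    ultimately have "sum z J \<in> Im_d" using A subspace_diff[OF subspace_Im_d] by auto
    moreover have "sum z J \<in> total k" using z(1) by (intro subspace_sum[OF subspace_total] A_sub_total) auto
    ultimately obtain u where u: "u \<in> total (k - 1)" "sum z J = d u" by (rule Im_d_total)
    have "del (sum z J) = 0" using closed_homogeneous(1)[OF z(1,2)] by (simp add: del_linear)
    then have uu: "del (delb u) = 0" by (simp add: u(2) d_def del_linear del_del)
    have cu: "del (delb (component r s u)) = 0" for r s
    proof -
      have "del (delb (component r s u)) = component (r + 1) (s + 1) (del (delb u))"
        by (simp add: component_del component_delb)
      then show ?thesis by (simp add: uu component_zero)
    qed
    have "z p = component p (k - p) (sum z J)"
    proof -
      have "component p (k - p) (sum z J) = (\<Sum>r\<in>J. if r = p then z r else 0)"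
        unfolding component_sum using component_homogeneous[OF z(1)] by (intro sum.cong) auto
      then show ?thesis using A p by simp
    qed
    also have "\<dots> = del (component (p - 1) (k - p) u) + delb (component p (k - p - 1) u)"
      by (simp add: u(2) component_d)
    finally have zp: "z p = del (component (p - 1) (k - p) u) + delb (component p (k - p - 1) u)" .
    have e: "k - 1 - (p - 1) = k - p" "k - 1 - p = k - p - 1" by simp_all
    have "del (component (p - 1) (k - p) u) \<in> Im_d"
      by (rule types_independent_exact(1)[OF R, of _ "p - 1"]) (simp_all add: e component_in cu)
    moreover have "delb (component p (k - p - 1) u) \<in> Im_d"
      by (rule types_independent_exact(2)[OF R, of _ p]) (simp_all add: e component_in cu)
    ultimately have "z p \<in> Im_d" unfolding zp by (rule subspace_add[OF subspace_Im_d])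
    then have "g p \<in> Im_d" using subspace_add[OF subspace_Im_d z(3)[OF p]] by fastforce
    moreover have "g p \<in> total k" using A p hodge_reps_sub by blast
    ultimately show "g p \<in> Im_d \<inter> total k" by blast
  qed
qed

lemma pure_Hodge_structure_iff: "pure_Hodge_structure k \<longleftrightarrow> types_span k \<and> types_independent k"
proof -
  have "pure_Hodge_structure k \<longleftrightarrow> F_tot k k = carrier (H_dR k) \<and> types_independent k"
    unfolding pure_Hodge_structure_def F_tot_def F_inter_F_conj H_dR_eq_Q
    by (subst subspace_pair.direct_sum_decomposition_Q[OF subspace_pair_H_dR])
      (use subspace_hodge_reps hodge_reps_sub independent_hodge_reps_iff in auto)
  then show ?thesis by (simp only: F_tot_weight_iff)
qed


section \<open>The purity defect\<close>

lemma F_tot_sub_carrier: "F_tot r k \<subseteq> carrier (H_dR k)"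
  using span_hodge_reps_sub[of k r] by (auto simp: F_tot_eq carrier_H_dR)

lemma zero_in_F_tot: "Im_d \<inter> total k \<in> F_tot r k"
proof -
  have "dR_class k 0 \<in> F_tot r k" unfolding F_tot_eq by (intro imageI span_zero)
  then show ?thesis by (simp only: dR_class_zero)
qed

lemma zero_in_carrier_H_dR: "Im_d \<inter> total k \<in> carrier (H_dR k)"
  using zero_in_F_tot F_tot_sub_carrier by (rule rev_subsetD)

lemma F_tot_Suc_sub: "F_tot (r + 1) k \<subseteq> F_tot r k"
proof -
  have "hodge_reps k p (r + 1 - p) \<subseteq> hodge_reps k p (r - p)" for p
  proof -
    have "Fil_conj (r + 1 - p) k \<subseteq> Fil_conj (r - p) k" by (auto simp: mem_Fil_conj_iff)
    then show ?thesis unfolding hodge_reps_def by blast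
  qed
  then have "(\<Union>p. hodge_reps k p (r + 1 - p)) \<subseteq> (\<Union>p. hodge_reps k p (r - p))" by blast
  then show ?thesis unfolding F_tot_eq by (intro image_mono span_mono)
qed

lemma F_tot_antimono: "a \<le> b \<Longrightarrow> F_tot b k \<subseteq> F_tot a k"
proof (induction b rule: int_ge_induct)
  case (step b)
  then show ?case using F_tot_Suc_sub[of b k] by blast
qed simp

lemma F_tot_chain:
  assumes "a \<le> b" "\<And>r. a \<le> r \<Longrightarrow> r < b \<Longrightarrow> F_tot r k \<subseteq> F_tot (r + 1) k"
  shows "F_tot a k \<subseteq> F_tot b k"
  using assms
proof (induction b rule: int_ge_induct)
  case (step b)
  then have "F_tot a k \<subseteq> F_tot b k" "F_tot b k \<subseteq> F_tot (b + 1) k" by simp_all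
  then show ?case by blast
qed simp

text \<open>The filtration step \<open>F_tot (r + 1) k\<close> is a set of cosets; its translate by a class \<open>X\<close> is itself exactly
  when \<open>X\<close> belongs to it.\<close>

lemma zero_gr_F_tot_iff: "zero_module (gr_F_tot r k) \<longleftrightarrow> F_tot r k \<subseteq> F_tot (r + 1) k"
proof -
  define U where "U = span (\<Union>p. hodge_reps k p (r + 1 - p))"
  have T': "F_tot (r + 1) k = dR_class k ` U" by (simp add: F_tot_eq U_def)
  have sum: "dR_class k y \<oplus>\<^bsub>H_dR k\<^esub> dR_class k x = dR_class k (y + x)" for x y
    unfolding H_dR_eq_Q by (rule subspace_pair.add_Q[OF subspace_pair_H_dR])
  have coset: "F_tot (r + 1) k +>\<^bsub>H_dR k\<^esub> dR_class k x = (\<lambda>y. dR_class k (y + x)) ` U" for x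
  proof -
    have "T +>\<^bsub>M\<^esub> X = (\<lambda>Y. Y \<oplus>\<^bsub>M\<^esub> X) ` T" for T X and M :: "(complex, 'a set) module"
      by (auto simp: a_r_coset_def r_coset_def)
    then show ?thesis by (simp only: T' image_image sum)
  qed
  have coset_eq: "F_tot (r + 1) k +>\<^bsub>H_dR k\<^esub> X = F_tot (r + 1) k \<longleftrightarrow> X \<in> F_tot (r + 1) k"
    if X: "X \<in> F_tot r k" for X
  proof
    assume L: "F_tot (r + 1) k +>\<^bsub>H_dR k\<^esub> X = F_tot (r + 1) k"
    obtain x where x: "X = dR_class k x" using X F_tot_eq by auto
    have "dR_class k (0 + x) \<in> F_tot (r + 1) k +>\<^bsub>H_dR k\<^esub> X"
      unfolding x coset by (rule imageI) (simp add: U_def span_zero)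
    then show "X \<in> F_tot (r + 1) k" unfolding L by (simp only: x add_0)
  next
    assume "X \<in> F_tot (r + 1) k"
    then obtain x where x: "X = dR_class k x" "x \<in> U" by (auto simp: T')
    have "dR_class k y \<in> (\<lambda>y. dR_class k (y + x)) ` U" if "y \<in> U" for y
      by (rule image_eqI[of _ _ "y - x"]) (use span_diff[OF that[unfolded U_def] x(2)[unfolded U_def]] in \<open>simp_all add: U_def\<close>)
    moreover have "dR_class k (y + x) \<in> dR_class k ` U" if "y \<in> U" for y
      using that x(2) span_add unfolding U_def by blast
    ultimately show "F_tot (r + 1) k +>\<^bsub>H_dR k\<^esub> X = F_tot (r + 1) k"
      unfolding x(1) coset unfolding T' by blast
  qed
  have "zero_module (gr_F_tot r k) \<longleftrightarrow>
      (\<lambda>X. F_tot (r + 1) k +>\<^bsub>H_dR k\<^esub> X) ` F_tot r k = {F_tot (r + 1) k}"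
    by (simp add: zero_module_def gr_F_tot_def quotient_module_def)
  also have "\<dots> \<longleftrightarrow> (\<forall>X\<in>F_tot r k. F_tot (r + 1) k +>\<^bsub>H_dR k\<^esub> X = F_tot (r + 1) k)"
    using zero_in_F_tot[of k r] by blast
  finally show ?thesis using coset_eq by auto
qed

lemma zero_H_dR_iff: "zero_module (H_dR k) \<longleftrightarrow> carrier (H_dR k) = {Im_d \<inter> total k}"
  unfolding zero_module_def H_dR_eq_Q subspace_pair.zero_Q[OF subspace_pair_H_dR] ..

end

context bounded_bicomplex
begin

lemma ex_bound: "\<exists>N\<ge>0. \<forall>p q. \<bar>p\<bar> > N \<or> \<bar>q\<bar> > N \<longrightarrow> A p q = {0}"
proof -
  define N where "N = Max (insert 0 ((\<lambda>(p, q). max \<bar>p\<bar> \<bar>q\<bar>) ` {(p, q). A p q \<noteq> {0}}))"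
  have fin: "finite (insert 0 ((\<lambda>(p, q). max \<bar>p\<bar> \<bar>q\<bar>) ` {(p, q). A p q \<noteq> {0}}))"
    using bounded by blast
  have "max \<bar>p\<bar> \<bar>q\<bar> \<le> N" if "A p q \<noteq> {0}" for p q
    unfolding N_def using that by (intro Max_ge[OF fin] insertI2 image_eqI[of _ _ "(p, q)"]) auto
  moreover have "0 \<le> N" unfolding N_def by (intro Max_ge[OF fin]) simp
  ultimately show ?thesis by (intro exI[of _ N]) (fastforce simp: not_less)
qed

definition bound :: int where
  "bound = (SOME N. 0 \<le> N \<and> (\<forall>p q. \<bar>p\<bar> > N \<or> \<bar>q\<bar> > N \<longrightarrow> A p q = {0}))"

lemma bound_nonneg: "0 \<le> bound"
  and component_zero_outside: "\<bar>p\<bar> > bound \<or> \<bar>q\<bar> > bound \<Longrightarrow> component p q x = 0"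
proof -
  have b: "0 \<le> bound \<and> (\<forall>p q. \<bar>p\<bar> > bound \<or> \<bar>q\<bar> > bound \<longrightarrow> A p q = {0})"
    unfolding bound_def by (rule someI_ex) (use ex_bound in blast)
  then show "0 \<le> bound" by simp
  show "\<bar>p\<bar> > bound \<or> \<bar>q\<bar> > bound \<Longrightarrow> component p q x = 0"
    using b component_in[of p q x] by auto
qed

text \<open>Every element of degree \<open>k\<close> lies in \<open>Fil (- bound) k\<close> and in \<open>Fil_conj (- bound) k\<close>.\<close>

lemma F_tot_exhaustive:
  assumes "r \<le> - 2 * bound"
  shows "F_tot r k = carrier (H_dR k)"
  unfolding F_tot_eq_carrier_iff
proof
  fix x assume x: "x \<in> Ker_d \<inter> total k"
  have "x \<in> Fil (- bound) k" "x \<in> Fil_conj (r - - bound) k"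
    using x assms by (auto simp: mem_Fil_iff mem_Fil_conj_iff intro!: component_zero_outside)
  moreover have "x - x \<in> Im_d" using subspace_0[OF subspace_Im_d] by simp
  ultimately have "x \<in> hodge_reps k (- bound) (r - - bound)"
    using x unfolding hodge_reps_def Ker_d_def by blast
  then show "x \<in> span (\<Union>p. hodge_reps k p (r - p))" by (intro span_base) blast
qed

text \<open>If \<open>p + q > 2 * bound\<close>, one of \<open>p\<close> and \<open>q\<close> exceeds the bound, and the corresponding filtration step on
  the bicomplex vanishes.\<close>

lemma F_tot_separated:
  assumes "2 * bound < r"
  shows "F_tot r k = {Im_d \<inter> total k}"
  unfolding F_tot_eq_zero_iff
proof (intro allI subsetI)
  fix p x assume x: "x \<in> hodge_reps k p (r - p)"
  have comp: "y = 0" if "\<And>p q. \<bar>p\<bar> \<le> bound \<Longrightarrow> \<bar>q\<bar> \<le> bound \<Longrightarrow> component p q y = 0" for y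
  proof (rule component_eqI)
    fix p q show "component p q y = component p q 0"
      using that[of p q] component_zero_outside[of p q y]
      by (cases "bound < \<bar>p\<bar> \<or> bound < \<bar>q\<bar>") (simp_all add: component_zero not_less)
  qed
  have "bound < p \<or> bound < r - p" using assms by auto
  then show "x \<in> Im_d"
  proof
    assume "bound < p"
    then have 0: "y = 0" if "y \<in> Fil p k" for y
      using that by - (rule comp, auto simp: mem_Fil_iff)
    obtain y where "y \<in> Fil p k" "x - y \<in> Im_d" using x by (auto simp: hodge_reps_def)
    then show ?thesis using 0[of y] by simp
  next
    assume "bound < r - p"
    then have 0: "y = 0" if "y \<in> Fil_conj (r - p) k" for y
      using that by - (rule comp, auto simp: mem_Fil_conj_iff)
    obtain y where "y \<in> Fil_conj (r - p) k" "x - y \<in> Im_d" using x by (auto simp: hodge_reps_def)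
    then show ?thesis using 0[of y] by simp
  qed
qed

lemma zero_gr_outside:
  assumes "r < - 2 * bound \<or> 2 * bound < r"
  shows "zero_module (gr_F_tot r k)"
  using assms
proof
  assume "r < - 2 * bound"
  then have "F_tot (r + 1) k = carrier (H_dR k)" by (intro F_tot_exhaustive) simp
  then show ?thesis using F_tot_sub_carrier by (simp add: zero_gr_F_tot_iff)
next
  assume "2 * bound < r"
  then have "F_tot r k = {Im_d \<inter> total k}" by (rule F_tot_separated)
  then show ?thesis using zero_in_F_tot by (simp add: zero_gr_F_tot_iff)
qed

lemma zero_gr_imp_zero_H_dR:
  assumes "\<And>r. zero_module (gr_F_tot r k)"
  shows "zero_module (H_dR k)"
proof -
  have "F_tot (- 2 * bound) k \<subseteq> F_tot (2 * bound + 1) k"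
  proof (rule F_tot_chain)
    show "F_tot r k \<subseteq> F_tot (r + 1) k" for r using assms[of r] by (simp only: zero_gr_F_tot_iff)
  qed (use bound_nonneg in simp)
  then have "carrier (H_dR k) \<subseteq> {Im_d \<inter> total k}"
    by (simp add: F_tot_exhaustive F_tot_separated)
  then show ?thesis using zero_in_carrier_H_dR[of k] unfolding zero_H_dR_iff by blast
qed

text \<open>With only one graded piece allowed to be nonzero, the decreasing filtration is constant below and
  above the weight \<open>k\<close>; exhaustiveness and separatedness identify the two constant values.\<close>

lemma zero_gr_off_weight_iff:
  "(\<forall>e. e \<noteq> 0 \<longrightarrow> zero_module (gr_F_tot (k + e) k)) \<longleftrightarrow>
    F_tot k k = carrier (H_dR k) \<and> F_tot (k + 1) k = {Im_d \<inter> total k}"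
proof
  assume L: "\<forall>e. e \<noteq> 0 \<longrightarrow> zero_module (gr_F_tot (k + e) k)"
  have step: "F_tot r k \<subseteq> F_tot (r + 1) k" if "r \<noteq> k" for r
    using L[THEN spec, of "r - k"] that by (simp add: zero_gr_F_tot_iff)
  have "F_tot (min k (- 2 * bound)) k \<subseteq> F_tot k k" by (rule F_tot_chain) (simp_all add: step)
  moreover have "F_tot (min k (- 2 * bound)) k = carrier (H_dR k)" by (rule F_tot_exhaustive) simp
  ultimately have "F_tot k k = carrier (H_dR k)" using F_tot_sub_carrier[of k k] by (intro equalityI) simp_all
  moreover have "F_tot (k + 1) k \<subseteq> F_tot (max (k + 1) (2 * bound + 1)) k" by (rule F_tot_chain) (simp_all add: step)
  moreover have "F_tot (max (k + 1) (2 * bound + 1)) k = {Im_d \<inter> total k}" by (rule F_tot_separated) simp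
  ultimately show "F_tot k k = carrier (H_dR k) \<and> F_tot (k + 1) k = {Im_d \<inter> total k}"
    using zero_in_F_tot[of k "k + 1"] by (simp add: set_eq_subset)
next
  assume R: "F_tot k k = carrier (H_dR k) \<and> F_tot (k + 1) k = {Im_d \<inter> total k}"
  show "\<forall>e. e \<noteq> 0 \<longrightarrow> zero_module (gr_F_tot (k + e) k)"
  proof (intro allI impI)
    fix e :: int assume "e \<noteq> 0"
    then consider "k + e + 1 \<le> k" | "k + 1 \<le> k + e" by linarith
    then show "zero_module (gr_F_tot (k + e) k)"
    proof cases
      case 1
      have "carrier (H_dR k) \<subseteq> F_tot (k + e + 1) k" using R F_tot_antimono[OF 1, of k] by simp
      then show ?thesis using F_tot_sub_carrier[of "k + e" k] unfolding zero_gr_F_tot_iff by order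
    next
      case 2
      have "F_tot (k + e) k \<subseteq> {Im_d \<inter> total k}" using R F_tot_antimono[OF 2, of k] by simp
      then show ?thesis using zero_in_F_tot[of k "k + e + 1"] unfolding zero_gr_F_tot_iff by blast
    qed
  qed
qed

text \<open>The set under the maximum is finite, because the filtration is, and nonempty unless the cohomology
  vanishes, because \<open>F_tot\<close> is exhaustive and separated; so the maximum is attained.\<close>

lemma pdef_deg_nonneg: "0 \<le> pdef_deg k"
  and pdef_deg_eq_0_iff: "pdef_deg k = 0 \<longleftrightarrow> F_tot k k = carrier (H_dR k) \<and> F_tot (k + 1) k = {Im_d \<inter> total k}"
proof -
  define E where "E = {\<bar>e\<bar> | e. \<not> zero_module (gr_F_tot (k + e) k)}"
  have "0 \<le> pdef_deg k \<and>
    (pdef_deg k = 0 \<longleftrightarrow> F_tot k k = carrier (H_dR k) \<and> F_tot (k + 1) k = {Im_d \<inter> total k})"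
  proof (cases "zero_module (H_dR k)")
    case True
    then have c: "carrier (H_dR k) = {Im_d \<inter> total k}" by (simp only: zero_H_dR_iff)
    have "F_tot r k = {Im_d \<inter> total k}" for r
      using F_tot_sub_carrier[of r k] zero_in_F_tot[of k r] unfolding c by blast
    then show ?thesis using True by (simp add: pdef_deg_def c)
  next
    case False
    have "E \<subseteq> abs ` {- 2 * bound - k..2 * bound - k}"
    proof
      fix m assume "m \<in> E"
      then obtain e where e: "m = \<bar>e\<bar>" "\<not> zero_module (gr_F_tot (k + e) k)" by (auto simp: E_def)
      then have "e \<in> {- 2 * bound - k..2 * bound - k}" using zero_gr_outside[of "k + e" k] by force
      then show "m \<in> abs ` {- 2 * bound - k..2 * bound - k}" using e(1) by blast
    qed
    then have fin: "finite E" by (rule finite_subset) simp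
    have ne: "E \<noteq> {}"
    proof
      assume "E = {}"
      then have "zero_module (gr_F_tot (k + e) k)" for e unfolding E_def by blast
      from this[of "r - k" for r] have "zero_module (gr_F_tot r k)" for r by simp
      then have "zero_module (H_dR k)" by (rule zero_gr_imp_zero_H_dR)
      then show False using False by simp
    qed
    have E0: "0 \<le> m" if "m \<in> E" for m using that by (auto simp: E_def)
    have pd: "pdef_deg k = Max E" using False by (simp add: pdef_deg_def E_def)
    have ge: "0 \<le> Max E" using E0 Max_in[OF fin ne] by blast
    have "Max E = 0 \<longleftrightarrow> (\<forall>m\<in>E. m = 0)"
    proof
      assume "Max E = 0"
      then have "m \<le> 0" if "m \<in> E" for m using Max_ge[OF fin that] by simp
      then show "\<forall>m\<in>E. m = 0" using E0 antisym by blast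
    qed (use Max_in[OF fin ne] in blast)
    also have "\<dots> \<longleftrightarrow> (\<forall>e. e \<noteq> 0 \<longrightarrow> zero_module (gr_F_tot (k + e) k))"
      by (auto simp: E_def)
    finally show ?thesis using pd ge zero_gr_off_weight_iff by simp
  qed
  then show "0 \<le> pdef_deg k"
    "pdef_deg k = 0 \<longleftrightarrow> F_tot k k = carrier (H_dR k) \<and> F_tot (k + 1) k = {Im_d \<inter> total k}" by auto
qed

lemma pdef_deg_outside:
  assumes "2 * bound < \<bar>k\<bar>"
  shows "pdef_deg k = 0"
proof -
  have "x = 0" if "x \<in> total k" for x
  proof (rule component_eqI)
    fix p q
    have "p + q \<noteq> k \<or> \<bar>p\<bar> > bound \<or> \<bar>q\<bar> > bound" using assms by linarith
    then show "component p q x = component p q 0"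
      using that component_zero_outside by (auto simp: mem_total_iff component_zero)
  qed
  then have "Ker_d \<inter> total k = {0}"
    using subspace_0[OF subspace_Ker_d] subspace_0[OF subspace_total] by auto
  then have "zero_module (H_dR k)"
    by (simp add: zero_H_dR_iff carrier_H_dR dR_class_zero)
  then show ?thesis by (simp add: pdef_deg_def)
qed

lemma pdef_eq_0_iff: "pdef = 0 \<longleftrightarrow> (\<forall>k. pdef_deg k = 0)"
proof -
  have "range pdef_deg \<subseteq> insert 0 (pdef_deg ` {- 2 * bound..2 * bound})"
  proof
    fix m assume "m \<in> range pdef_deg"
    then obtain k where k: "m = pdef_deg k" by blast
    show "m \<in> insert 0 (pdef_deg ` {- 2 * bound..2 * bound})"
    proof (cases "2 * bound < \<bar>k\<bar>")
      case False
      then have "k \<in> {- 2 * bound..2 * bound}" by auto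
      then show ?thesis unfolding k by (intro insertI2 imageI)
    qed (simp add: k pdef_deg_outside)
  qed
  then have fin: "finite (range pdef_deg)" by (rule finite_subset) simp
  show ?thesis
  proof
    assume "pdef = 0"
    then have "pdef_deg k \<le> 0" for k using Max_ge[OF fin, of "pdef_deg k"] by (simp add: pdef_def)
    then show "\<forall>k. pdef_deg k = 0" using pdef_deg_nonneg antisym by blast
  next
    assume "\<forall>k. pdef_deg k = 0"
    then have "range pdef_deg = {0}" by auto
    then show "pdef = 0" by (simp add: pdef_def)
  qed
qed

text \<open>Purity in degree \<open>k\<close> corresponds to the first obstruction in degree \<open>k + 1\<close> and the second in degree
  \<open>k - 1\<close>, so the equivalence with vanishing obstructions is a statement about all \<open>k\<close>.\<close>

lemma purity_equivalences:
  "pdef = 0 \<longleftrightarrow> (\<forall>k. pure_Hodge_structure k)"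
  "(\<forall>k. pure_Hodge_structure k) \<longleftrightarrow> (\<forall>k. zero_module (H_urcorner k) \<and> zero_module (H_llcorner k))"
proof -
  show "pdef = 0 \<longleftrightarrow> (\<forall>k. pure_Hodge_structure k)"
    by (simp add: pdef_eq_0_iff pdef_deg_eq_0_iff F_tot_weight_iff F_tot_weight_Suc_iff pure_Hodge_structure_iff)
  have "zero_module (H_urcorner k) \<longleftrightarrow> types_span (k - 1)" "zero_module (H_llcorner k) \<longleftrightarrow> types_independent (k + 1)" for k
    using zero_H_urcorner_iff_types_span[of "k - 1"] zero_H_llcorner_iff_types_independent[of "k + 1"] by simp_all
  then show "(\<forall>k. pure_Hodge_structure k) \<longleftrightarrow> (\<forall>k. zero_module (H_urcorner k) \<and> zero_module (H_llcorner k))"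
  proof (intro iffI allI)
    fix k
    assume "\<forall>k. zero_module (H_urcorner k) \<and> zero_module (H_llcorner k)"
    then show "pure_Hodge_structure k"
      by (simp add: pure_Hodge_structure_iff flip: zero_H_urcorner_iff_types_span zero_H_llcorner_iff_types_independent)
  qed (simp add: pure_Hodge_structure_iff)
qed

end

theorem theorem3p28:
  fixes scale :: "complex \<Rightarrow> 'a::ab_group_add \<Rightarrow> 'a"
    and A :: "int \<Rightarrow> int \<Rightarrow> 'a set" and del delb :: "'a \<Rightarrow> 'a"
  assumes "bounded_bicomplex scale A del delb"
  shows
    "(bicomplex.pdef scale A del delb = 0 \<longleftrightarrow>
        (\<forall>k. bicomplex.pure_Hodge_structure scale A del delb k)) \<and>
     ((\<forall>k. bicomplex.pure_Hodge_structure scale A del delb k) \<longleftrightarrow>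
        (\<forall>k. zero_module (bicomplex.H_urcorner scale A del delb k) \<and>
             zero_module (bicomplex.H_llcorner scale A del delb k))) \<and>
     ((\<forall>k. zero_module (bicomplex.H_urcorner scale A del delb k) \<and>
           zero_module (bicomplex.H_llcorner scale A del delb k)) \<longleftrightarrow>
        (\<forall>k. linear_iso (bicomplex.H_BC scale A del delb k) (bicomplex.H_Ker_dc scale A del delb k)
               (bicomplex.phi scale A del delb k) \<and>
             linear_iso (bicomplex.H_mod_Im_dc scale A del delb k) (bicomplex.H_A scale A del delb k)
               (bicomplex.psi scale A del delb k)))"
proof -
  interpret bounded_bicomplex scale A del delb by (rule assms)
  show ?thesis using purity_equivalences by (simp only: phi_iso_iff psi_iso_iff simp_thms)
qed

end
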